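(* (i) For any odd prime number $p$, every $pE$-group of order at most $p^7$ is abelian. (ii) There exist non-abelian $2E$-groups of order $2^7$.
   Context: A group $G$ is called an $E$-group if every element of $G$ commutes with each of its endomorphic images, i.e. $x\,x^{\alpha}=x^{\alpha}x$ for every $x\in G$ and every endomorphism $\alpha$ of $G$. For a prime $p$, a $pE$-group is an $E$-group which is also a $p$-group (so a $2E$-group is an $E$-group which is a $2$-group). *)

theory Defs
  imports "HOL-Algebra.Algebra" "HOL-Computational_Algebra.Primes"
begin

text \<open>
  Endomorphisms of \<open>G\<close> are the elements of \<open>hom G G\<close>; their values outside the carrier are
  arbitrary but play no role, since \<open>x\<close> ranges over the carrier.
\<close>
definition E_group :: "('a, 'b) monoid_scheme \<Rightarrow> bool" where
  "E_group G \<longleftrightarrow> group G \<and>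
     (\<forall>\<alpha>\<in>hom G G. \<forall>x\<in>carrier G. x \<otimes>\<^bsub>G\<^esub> \<alpha> x = \<alpha> x \<otimes>\<^bsub>G\<^esub> x)"

text \<open>
  Infinite groups are allowed. Elements of infinite order are excluded because
  \<open>group.ord\<close> is \<open>0\<close> on them, which is not a power of a prime.
\<close>
definition p_group :: "nat \<Rightarrow> ('a, 'b) monoid_scheme \<Rightarrow> bool" where
  "p_group p G \<longleftrightarrow> Factorial_Ring.prime p \<and> group G \<and> (\<forall>x\<in>carrier G. \<exists>k. group.ord G x = p ^ k)"

definition pE_group :: "nat \<Rightarrow> ('a, 'b) monoid_scheme \<Rightarrow> bool" where
  "pE_group p G \<longleftrightarrow> E_group G \<and> p_group p G"

end

theory Submission
  imports Defs "HOL-Library.Z2" "HOL-Library.Product_Plus"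
begin

text \<open>
  (i) An E-group is 2-Engel, so by Levi's identities triple commutators are alternating of order dividing 3.
  Let \<open>p\<^sup>e\<close> be the exponent of \<open>G/G'\<close>. A cyclic quotient of order \<open>p\<^sup>e\<close> yields, for each \<open>z\<close> with
  \<open>z ^ p\<^sup>e = 1\<close>, an endomorphism with image generated by \<open>z\<close>, and hence such \<open>z\<close> are central. For
  \<open>p = 3\<close> this makes a group of class 3 too large. In class 2 the map \<open>x \<mapsto> x ^ p\<^sup>e\<close> is a homomorphism
  into \<open>G'\<close> with central kernel, so \<open>|G/Z| \<le> |G'| \<le> |Z|\<close>; for \<open>|G| \<le> p\<^sup>7\<close> counting leaves only the case where
  \<open>G/Z\<close> and \<open>G'\<close> are elementary abelian of rank 3 and \<open>x \<mapsto> x\<^sup>p\<close> induces an isomorphism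
  \<open>G/Z \<rightarrow> G'\<close>. As \<open>G'\<close> is the exterior square of \<open>V = G/Z\<close>, that is the dual of \<open>V\<close> up to a determinant,
  this isomorphism is a nondegenerate bilinear form \<open>B\<close> on \<open>V\<close>, and the automorphisms of \<open>V\<close> with
  \<open>B(Mx, My) = det M B(x, y)\<close> lift to endomorphisms of \<open>G\<close>. The asymmetry of \<open>B\<close>, or a half turn
  if \<open>B\<close> is symmetric, is such a map and is not scalar, so it moves some \<open>x\<close> to an element not commuting with \<open>x\<close>.

  (ii) A central extension of \<open>F\<^sub>2\<^sup>4\<close> by \<open>F\<^sub>2\<^sup>3\<close> is determined by its squaring map, a quadratic
  map. For a suitable one every endomorphism induces 0 or the identity on the quotient, and such
  endomorphisms send \<open>x\<close> to elements commuting with \<open>x\<close>.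
\<close>

section \<open>Commutators\<close>

text \<open>Where 7 enters: |G/Z| <= |G'| <= |Z| and |G| <= p^7 give |G/Z| <= p^3, while |G/Z| = p^2
  would leave G' of order p, too small for the power map. Rank 3 is also the only positive rank in
  which V and its exterior square have the same dimension. Why one nonscalar similitude suffices:
  the three basic commutators are independent mod p, so elements of G commute only if their images
  in V are linearly dependent. The E-condition thus makes every vector of V an eigenvector, and only
  scalars do that. Why the asymmetry fails only for symmetric forms: if it is a scalar c, then B^T =
  cB, so c^2 = 1, and comparing 3 x 3 determinants gives c^3 = 1; hence c = 1. No decomposition of
  G/G' into cyclic factors is made: the one cyclic quotient needed comes from a subgroup maximal
  among those avoiding a chosen element. Endomorphisms are given by multiplicatively closed
  relations, and well-definedness is reduced to the fibre over the identity, that is, to the ways of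
  writing 1 in normal form.\<close>

context group
begin

definition comm :: "'a \<Rightarrow> 'a \<Rightarrow> 'a" where
  "comm x y = x \<otimes> y \<otimes> inv x \<otimes> inv y"

definition centre :: "'a set" where
  "centre = {z \<in> carrier G. \<forall>x\<in>carrier G. z \<otimes> x = x \<otimes> z}"

definition centralizer :: "'a \<Rightarrow> 'a set" where
  "centralizer g = {x \<in> carrier G. x \<otimes> g = g \<otimes> x}"

lemma inv_cancel_left [simp]:
  assumes "x \<in> carrier G" "y \<in> carrier G"
  shows "inv x \<otimes> (x \<otimes> y) = y" "x \<otimes> (inv x \<otimes> y) = y"
  using assms by (simp_all flip: m_assoc)

lemmas group_word = m_assoc inv_mult_group

lemma comm_closed [simp]: "x \<in> carrier G \<Longrightarrow> y \<in> carrier G \<Longrightarrow> comm x y \<in> carrier G"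
  by (simp add: comm_def)

lemma comm_eq_one_iff:
  assumes "x \<in> carrier G" "y \<in> carrier G"
  shows "comm x y = \<one> \<longleftrightarrow> x \<otimes> y = y \<otimes> x"
proof -
  have "comm x y \<otimes> (y \<otimes> x) = x \<otimes> y"
    using assms by (simp add: comm_def group_word)
  moreover have "comm x y = \<one> \<longleftrightarrow> comm x y \<otimes> (y \<otimes> x) = \<one> \<otimes> (y \<otimes> x)"
    using assms by (subst r_cancel) (simp_all)
  ultimately show ?thesis
    using assms by simp
qed

lemma inv_comm: "x \<in> carrier G \<Longrightarrow> y \<in> carrier G \<Longrightarrow> inv (comm x y) = comm y x"
  by (simp add: comm_def group_word)

lemma inv_commute:
  assumes "a \<otimes> x = x \<otimes> a" "a \<in> carrier G" "x \<in> carrier G"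
  shows "inv a \<otimes> x = x \<otimes> inv a"
proof -
  have "inv a \<otimes> x = inv a \<otimes> (x \<otimes> a) \<otimes> inv a"
    using assms(2,3) by (simp add: m_assoc)
  also have "\<dots> = x \<otimes> inv a"
    using assms by (simp add: assms(1)[symmetric] m_assoc)
  finally show ?thesis .
qed

lemma mult_commute:
  assumes "a \<otimes> x = x \<otimes> a" "b \<otimes> x = x \<otimes> b" "a \<in> carrier G" "b \<in> carrier G" "x \<in> carrier G"
  shows "(a \<otimes> b) \<otimes> x = x \<otimes> (a \<otimes> b)"
proof -
  have "(a \<otimes> b) \<otimes> x = (a \<otimes> x) \<otimes> b"
    using assms(2-5) by (simp add: m_assoc)
  then show ?thesis
    using assms by (simp add: m_assoc)
qed

lemma centre_subgroup: "subgroup centre G"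
proof (rule subgroupI)
  fix a assume "a \<in> centre"
  then show "inv a \<in> centre" unfolding centre_def by (blast intro: inv_commute)
next
  fix a b assume "a \<in> centre" "b \<in> centre"
  then show "a \<otimes> b \<in> centre"
    unfolding centre_def by (blast intro: mult_commute)
qed (auto simp: centre_def)

lemma centralizer_subgroup:
  assumes "g \<in> carrier G" shows "subgroup (centralizer g) G"
proof (rule subgroupI)
  fix a assume "a \<in> centralizer g"
  with assms show "inv a \<in> centralizer g" unfolding centralizer_def by (blast intro: inv_commute)
next
  fix a b assume "a \<in> centralizer g" "b \<in> centralizer g"
  with assms show "a \<otimes> b \<in> centralizer g"
    unfolding centralizer_def by (blast intro: mult_commute)
qed (use assms in \<open>auto simp: centralizer_def\<close>)

lemma centre_carrier: "z \<in> centre \<Longrightarrow> z \<in> carrier G"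
  by (simp add: centre_def)

lemma centre_commute:
  assumes "z \<in> centre" "x \<in> carrier G"
  shows "x \<otimes> z = z \<otimes> x"
proof -
  have "z \<otimes> x = x \<otimes> z"
    using assms unfolding centre_def by blast
  then show ?thesis by (rule sym)
qed

lemma centre_left_commute:
  assumes "z \<in> centre" "x \<in> carrier G" "y \<in> carrier G"
  shows "x \<otimes> (z \<otimes> y) = z \<otimes> (x \<otimes> y)"
  using assms centre_carrier[OF assms(1)] by (simp flip: m_assoc add: centre_commute[OF assms(1,2)])

lemma centre_iff: "z \<in> centre \<longleftrightarrow> z \<in> carrier G \<and> (\<forall>x\<in>carrier G. comm z x = \<one>)"
  unfolding centre_def by (blast intro: comm_eq_one_iff[THEN iffD1] comm_eq_one_iff[THEN iffD2])

lemma centralizer_iff: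
  "g \<in> carrier G \<Longrightarrow> x \<in> centralizer g \<longleftrightarrow> x \<in> carrier G \<and> comm x g = \<one>"
  unfolding centralizer_def by (blast intro: comm_eq_one_iff[THEN iffD1] comm_eq_one_iff[THEN iffD2])

lemma comm_swap_eq_one: "x \<in> carrier G \<Longrightarrow> y \<in> carrier G \<Longrightarrow> comm x y = \<one> \<Longrightarrow> comm y x = \<one>"
  using inv_comm[of x y] by simp

lemma conj_int_pow:
  assumes "x \<in> carrier G" "g \<in> carrier G"
  shows "(g \<otimes> x \<otimes> inv g) [^] (n::int) = g \<otimes> x [^] n \<otimes> inv g"
proof -
  have "(\<lambda>x. g \<otimes> x \<otimes> inv g) \<in> hom G G"
    using assms by (auto simp: hom_def group_word)
  then interpret group_hom G G "\<lambda>x. g \<otimes> x \<otimes> inv g"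
    by unfold_locales
  show ?thesis using hom_int_pow[OF assms(1)] by simp
qed


lemma comm_mult_left:
  assumes "x \<in> carrier G" "y \<in> carrier G" "z \<in> carrier G" "comm y z \<in> centre"
  shows "comm (x \<otimes> y) z = comm x z \<otimes> comm y z"
proof -
  have "comm (x \<otimes> y) z = x \<otimes> comm y z \<otimes> inv x \<otimes> comm x z"
    using assms(1-3) by (simp add: comm_def group_word)
  also have "\<dots> = comm y z \<otimes> comm x z"
    using assms by (simp add: centre_left_commute[OF assms(4,1)] m_assoc)
  also have "\<dots> = comm x z \<otimes> comm y z"
    using assms by (simp add: centre_commute[OF assms(4), of "comm x z"])
  finally show ?thesis .
qed

lemma comm_mult_right:
  assumes "x \<in> carrier G" "y \<in> carrier G" "z \<in> carrier G" "comm x z \<in> centre"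
  shows "comm x (y \<otimes> z) = comm x y \<otimes> comm x z"
proof -
  have "comm x (y \<otimes> z) = comm x y \<otimes> (y \<otimes> comm x z \<otimes> inv y)"
    using assms(1-3) by (simp add: comm_def group_word)
  also have "y \<otimes> comm x z \<otimes> inv y = comm x z"
    using assms by (simp add: centre_left_commute[OF assms(4,2)] m_assoc)
  finally show ?thesis .
qed

lemma comm_in_derived [simp]:
  "x \<in> carrier G \<Longrightarrow> y \<in> carrier G \<Longrightarrow> comm x y \<in> derived G (carrier G)"
  unfolding derived_def comm_def by (rule generate.incl) auto

lemma derived_subset:
  assumes "subgroup H G" "\<And>x y. x \<in> carrier G \<Longrightarrow> y \<in> carrier G \<Longrightarrow> comm x y \<in> H"
  shows "derived G (carrier G) \<subseteq> H"
  unfolding derived_def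
  using assms(2) by (intro generate_subgroup_incl[OF _ assms(1)]) (auto simp: comm_def)

lemma derived_subgroup: "subgroup (derived G (carrier G)) G"
  by (simp add: derived_is_subgroup)

lemma derived_carrier [simp]: "x \<in> derived G (carrier G) \<Longrightarrow> x \<in> carrier G"
  using derived_in_carrier[of "carrier G"] by auto

end

section \<open>2-Engel groups\<close>

text \<open>Additively: a + b = 2x, c + b = 2d, e + c = 2f, k + d = 2x. Eliminating b, c, d leaves a
  + e + 2x = 2f + 2k. The letters stand for the conjugates of \<open>x\<close> chosen in
  \<open>triple_comm_swap\<close>.\<close>

lemma (in comm_group) levi_elimination:
  assumes [simp]: "x \<in> carrier G" "a \<in> carrier G" "b \<in> carrier G" "c \<in> carrier G" "d \<in> carrier G"
    "e \<in> carrier G" "f \<in> carrier G" "k \<in> carrier G"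
  assumes ab: "a \<otimes> b = x \<otimes> x" and cb: "c \<otimes> b = d \<otimes> d" and ec: "e \<otimes> c = f \<otimes> f" and kd: "k \<otimes> d = x \<otimes> x"
  shows "a \<otimes> e \<otimes> (x \<otimes> x) = (f \<otimes> f) \<otimes> (k \<otimes> k)"
proof -
  have "(a \<otimes> e \<otimes> (x \<otimes> x)) \<otimes> (x \<otimes> x) = (a \<otimes> e \<otimes> (k \<otimes> d)) \<otimes> (k \<otimes> d)"
    by (simp add: kd)
  also have "\<dots> = a \<otimes> e \<otimes> (k \<otimes> k) \<otimes> (d \<otimes> d)"
    by (simp add: m_ac)
  also have "\<dots> = (a \<otimes> b) \<otimes> (e \<otimes> c) \<otimes> (k \<otimes> k)"
    by (simp add: cb[symmetric] m_ac)
  also have "\<dots> = ((f \<otimes> f) \<otimes> (k \<otimes> k)) \<otimes> (x \<otimes> x)"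
    unfolding ab ec by (simp add: m_ac)
  finally show ?thesis
    by simp
qed

lemma (in comm_group) levi_collect:
  assumes [simp]: "x \<in> carrier G" "a \<in> carrier G" "e \<in> carrier G" "f \<in> carrier G" "k \<in> carrier G"
  assumes "a \<otimes> e \<otimes> (x \<otimes> x) = (f \<otimes> f) \<otimes> (k \<otimes> k)"
  shows "(x \<otimes> inv k \<otimes> (a \<otimes> inv f)) \<otimes> (x \<otimes> inv f \<otimes> (e \<otimes> inv k)) = \<one>"
proof -
  have "(x \<otimes> inv k \<otimes> (a \<otimes> inv f)) \<otimes> (x \<otimes> inv f \<otimes> (e \<otimes> inv k)) = (a \<otimes> e \<otimes> (x \<otimes> x)) \<otimes> inv ((f \<otimes> f) \<otimes> (k \<otimes> k))"
    by (simp add: m_ac inv_mult)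
  then show ?thesis by (simp add: assms(6))
qed

context group begin

definition conj :: "'a \<Rightarrow> 'a \<Rightarrow> 'a" where
  "conj g x = g \<otimes> x \<otimes> inv g"

lemma conj_closed [simp]: "g \<in> carrier G \<Longrightarrow> x \<in> carrier G \<Longrightarrow> conj g x \<in> carrier G"
  by (simp add: conj_def)

lemma conj_one [simp]: "x \<in> carrier G \<Longrightarrow> conj \<one> x = x"
  by (simp add: conj_def)

lemma conj_conj [simp]:
  "g \<in> carrier G \<Longrightarrow> h \<in> carrier G \<Longrightarrow> x \<in> carrier G \<Longrightarrow> conj g (conj h x) = conj (g \<otimes> h) x"
  by (simp add: conj_def group_word)

lemma conj_mult:
  "g \<in> carrier G \<Longrightarrow> x \<in> carrier G \<Longrightarrow> y \<in> carrier G \<Longrightarrow> conj g (x \<otimes> y) = conj g x \<otimes> conj g y"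
  by (simp add: conj_def group_word)

lemma generate_commute:
  assumes S: "S \<subseteq> carrier G" and "\<And>a b. a \<in> S \<Longrightarrow> b \<in> S \<Longrightarrow> a \<otimes> b = b \<otimes> a"
    and "a \<in> generate G S" "b \<in> generate G S"
  shows "a \<otimes> b = b \<otimes> a"
proof -
  have 1: "x \<otimes> s = s \<otimes> x" if "x \<in> generate G S" "s \<in> S" for x s
  proof -
    have "generate G S \<subseteq> centralizer s"
      using that S assms(2) by (intro generate_subgroup_incl centralizer_subgroup) (auto simp: centralizer_def)
    then show ?thesis using that by (auto simp: centralizer_def)
  qed
  have a: "a \<in> carrier G"
    using generate_in_carrier[OF S] assms(3) by blast
  have "generate G S \<subseteq> centralizer a"
    using S a 1[OF assms(3)]
    by (intro generate_subgroup_incl centralizer_subgroup) (auto simp: centralizer_def intro: sym)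
  then show ?thesis using assms(4) unfolding centralizer_def by force
qed

end

text \<open>Equivalent to the 2-Engel law \<open>comm (comm g x) x = \<one>\<close>. In terms of
  conjugates it makes the normal closure of each element abelian, so that the group acts on it
  linearly.\<close>

locale two_engel = group G for G (structure) +
  assumes engel: "x \<in> carrier G \<Longrightarrow> g \<in> carrier G \<Longrightarrow> x \<otimes> conj g x = conj g x \<otimes> x"
begin

lemma conj_commute:
  assumes [simp]: "x \<in> carrier G" "g \<in> carrier G" "h \<in> carrier G"
  shows "conj g x \<otimes> conj h x = conj h x \<otimes> conj g x"
proof -
  have "conj g (x \<otimes> conj (inv g \<otimes> h) x) = conj g (conj (inv g \<otimes> h) x \<otimes> x)"
    using engel[of x "inv g \<otimes> h"] by simp
  then show ?thesis
    by (simp add: conj_mult)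
qed

lemma comm_group_normal_closure:
  assumes "x \<in> carrier G"
  shows "comm_group (G\<lparr>carrier := generate G ((\<lambda>g. conj g x) ` carrier G)\<rparr>)"
proof -
  let ?S = "(\<lambda>g. conj g x) ` carrier G"
  have S: "?S \<subseteq> carrier G" using assms by auto
  interpret H: group "G\<lparr>carrier := generate G ?S\<rparr>"
    by (rule subgroup_imp_group[OF generate_is_subgroup[OF S]])
  show ?thesis
    by (rule H.group_comm_groupI, simp, rule generate_commute[OF S])
      (auto simp: conj_commute assms)
qed

text \<open>Additively \<open>(g - 1)^2 n = 0\<close>. The source is the Engel law for
  \<open>g\<close> and its conjugate by \<open>n\<close>, expanded; the law for \<open>n\<close>
  itself only serves to reorder conjugates of \<open>n\<close>.\<close>

lemma conj_square:
  assumes [simp]: "n \<in> carrier G" "g \<in> carrier G"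
  shows "conj (g \<otimes> g) n \<otimes> n = conj g n \<otimes> conj g n"
proof -
  define k where "k = conj g n"
  have [simp]: "k \<in> carrier G" by (simp add: k_def)
  have "g \<otimes> conj n g = conj n g \<otimes> g" by (simp add: engel)
  then have "n \<otimes> (inv n \<otimes> (g \<otimes> conj n g) \<otimes> n \<otimes> inv (g \<otimes> g)) = n \<otimes> (inv n \<otimes> (conj n g \<otimes> g) \<otimes> n \<otimes> inv (g \<otimes> g))"
    by simp
  moreover have "n \<otimes> (inv n \<otimes> (g \<otimes> conj n g) \<otimes> n \<otimes> inv (g \<otimes> g)) = k"
    by (simp add: conj_def k_def group_word)
  moreover have "n \<otimes> (inv n \<otimes> (conj n g \<otimes> g) \<otimes> n \<otimes> inv (g \<otimes> g)) = n \<otimes> inv k \<otimes> conj (g \<otimes> g) n"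
    by (simp add: conj_def k_def group_word)
  ultimately have "k = n \<otimes> inv k \<otimes> conj (g \<otimes> g) n"
    by simp
  moreover have "n \<otimes> inv k = inv k \<otimes> n"
    using engel[of n g] by (metis assms conj_closed inv_commute k_def)
  ultimately have "k \<otimes> k = k \<otimes> (inv k \<otimes> n \<otimes> conj (g \<otimes> g) n)"
    by metis
  also have "\<dots> = n \<otimes> conj (g \<otimes> g) n" by (simp add: m_assoc)
  also have "\<dots> = conj (g \<otimes> g) n \<otimes> n" by (simp add: engel)
  finally show ?thesis by (simp add: k_def)
qed

lemma conj_inv:
  assumes [simp]: "n \<in> carrier G" "g \<in> carrier G"
  shows "conj g n \<otimes> conj (inv g) n = n \<otimes> n"
  using conj_square[of "conj (inv g) n" g] by (simp add: m_assoc)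

text \<open>Squares of \<open>g\<close>, \<open>h\<close> and \<open>g h\<close> act on the abelian normal closure of \<open>x\<close> with
  \<open>(g - 1)\<^sup>2 = 0\<close>; hence \<open>(g - 1)(h - 1) + (h - 1)(g - 1) = 0\<close>.\<close>
lemma triple_comm_swap:
  assumes [simp]: "x \<in> carrier G" "g \<in> carrier G" "h \<in> carrier G"
  shows "comm (comm x g) h \<otimes> comm (comm x h) g = \<one>"
proof -
  let ?N = "generate G ((\<lambda>g. conj g x) ` carrier G)"
  interpret N: comm_group "G\<lparr>carrier := ?N\<rparr>"
    by (rule comm_group_normal_closure) simp
  have in_N: "conj a x \<in> ?N" if "a \<in> carrier G" for a
    using that by (auto intro: generate.incl)
  have xN: "x \<in> ?N" using in_N[of \<one>] by simp
  have sub: "subgroup ?N G"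
    by (rule generate_is_subgroup) auto
  have inv_N: "inv\<^bsub>G\<lparr>carrier := ?N\<rparr>\<^esub> a = inv a" if "a \<in> ?N" for a
    using m_inv_consistent[OF sub that] .
  \<comment> \<open>The relations among these conjugates are all instances of
    \<open>g + g^-1 = 2\<close> (\<open>conj_inv\<close>): for \<open>h g\<close> on
    \<open>x\<close>, for \<open>h\<close> on \<open>x\<close> translated by \<open>inv g\<close>,
    for \<open>g\<close> on \<open>conj h x\<close>, and for \<open>g\<close> on
    \<open>x\<close>.\<close>
  define a b c d e f k where abc: "a = conj (h \<otimes> g) x" "b = conj (inv g \<otimes> inv h) x" "c = conj (inv g \<otimes> h) x"
    "d = conj (inv g) x" "e = conj (g \<otimes> h) x" "f = conj h x" "k = conj g x"
  have abc_N: "a \<in> ?N" "b \<in> ?N" "c \<in> ?N" "d \<in> ?N" "e \<in> ?N" "f \<in> ?N" "k \<in> ?N"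
    unfolding abc by (simp_all add: in_N)
  have ab: "a \<otimes> b = x \<otimes> x"
    using conj_inv[of x "h \<otimes> g"] by (simp add: abc group_word)
  have cb: "c \<otimes> b = d \<otimes> d"
    using arg_cong[OF conj_inv[of x h], of "conj (inv g)"] by (simp add: abc conj_mult)
  have ec: "e \<otimes> c = f \<otimes> f"
    using conj_inv[of "conj h x" g] by (simp add: abc)
  have kd: "k \<otimes> d = x \<otimes> x"
    using conj_inv[of x g] by (simp add: abc)
  have "a \<otimes> e \<otimes> (x \<otimes> x) = (f \<otimes> f) \<otimes> (k \<otimes> k)"
    using N.levi_elimination[of x a b c d e f k] ab cb ec kd abc_N xN by simp
  then have "(x \<otimes> inv k \<otimes> (a \<otimes> inv f)) \<otimes> (x \<otimes> inv f \<otimes> (e \<otimes> inv k)) = \<one>"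
    using N.levi_collect[of x a e f k] abc_N xN by (simp add: inv_N)
  moreover have "comm (comm x g) h = x \<otimes> inv k \<otimes> (a \<otimes> inv f)"
    by (simp add: comm_def abc conj_def group_word)
  moreover have "comm (comm x h) g = x \<otimes> inv f \<otimes> (e \<otimes> inv k)"
    by (simp add: comm_def abc conj_def group_word)
  ultimately show ?thesis by simp
qed

end

lemma (in group) hall_witt:
  assumes "x \<in> carrier G" "y \<in> carrier G" "z \<in> carrier G"
  shows "conj x (comm y (comm (inv x) z)) \<otimes> conj z (comm x (comm (inv z) y)) \<otimes> conj y (comm z (comm (inv y) x)) = \<one>"
  using assms by (simp add: conj_def comm_def group_word)

context two_engel begin

lemma comm_commute:
  assumes [simp]: "x \<in> carrier G" "y \<in> carrier G"
  shows "comm x y \<otimes> x = x \<otimes> comm x y" "comm x y \<otimes> y = y \<otimes> comm x y"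
proof -
  have "inv (conj y x) \<otimes> x = x \<otimes> inv (conj y x)"
    by (rule inv_commute) (simp_all add: engel)
  moreover have "comm x y = x \<otimes> inv (conj y x)"
    by (simp add: comm_def conj_def group_word)
  ultimately show "comm x y \<otimes> x = x \<otimes> comm x y"
    by (simp add: m_assoc)
  have "comm x y = conj x y \<otimes> inv y"
    by (simp add: comm_def conj_def group_word)
  moreover have "inv y \<otimes> y = y \<otimes> inv y" by simp
  ultimately show "comm x y \<otimes> y = y \<otimes> comm x y"
    using mult_commute[of "conj x y" y "inv y"] by (simp add: engel)
qed

lemma comm_inv_left:
  assumes [simp]: "x \<in> carrier G" "y \<in> carrier G"
  shows "comm (inv x) y = inv (comm x y)"
proof -
  have "comm (inv x) y = inv x \<otimes> inv (comm x y) \<otimes> x"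
    by (simp add: comm_def group_word)
  also have "\<dots> = inv x \<otimes> (x \<otimes> inv (comm x y))"
    using inv_commute[OF comm_commute(1)[of x y]] by (simp add: m_assoc)
  finally show ?thesis by simp
qed

lemma comm_inv_right:
  assumes [simp]: "x \<in> carrier G" "y \<in> carrier G"
  shows "comm x (inv y) = inv (comm x y)"
  using comm_inv_left[of y x] by (metis assms comm_closed inv_closed inv_comm)

lemma triple_comm_swap_left:
  assumes [simp]: "x \<in> carrier G" "y \<in> carrier G" "z \<in> carrier G"
  shows "comm (comm y x) z = inv (comm (comm x y) z)"
  using comm_inv_left[of "comm x y" z] by (simp add: inv_comm)

lemma triple_comm_swap_right:
  assumes [simp]: "x \<in> carrier G" "y \<in> carrier G" "z \<in> carrier G"
  shows "comm (comm x z) y = inv (comm (comm x y) z)"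
  using triple_comm_swap[of x z y] by (simp add: inv_equality)

lemma triple_comm_rotate:
  assumes [simp]: "x \<in> carrier G" "y \<in> carrier G" "z \<in> carrier G"
  shows "comm (comm y z) x = comm (comm x y) z"
  by (simp add: triple_comm_swap_right[of y x z] triple_comm_swap_left[of x y z])

text \<open>By the alternating property the three inner factors of the Hall-Witt identity all equal
  \<open>inv t\<close>. Rotation puts each of \<open>x\<close>, \<open>y\<close>, \<open>z\<close>
  in last position, so \<open>t\<close> commutes with all three and the outer conjugations
  disappear.\<close>

lemma triple_comm_cube:
  assumes [simp]: "x \<in> carrier G" "y \<in> carrier G" "z \<in> carrier G"
  shows "comm (comm x y) z [^] (3::nat) = \<one>"
proof -
  define t where "t = comm (comm x y) z"
  have [simp]: "t \<in> carrier G" by (simp add: t_def)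
  have "t \<otimes> x = x \<otimes> t"
    using comm_commute(2)[of "comm y z" x] by (simp add: t_def triple_comm_rotate)
  moreover have "t \<otimes> z = z \<otimes> t"
    using comm_commute(2)[of "comm x y" z] by (simp add: t_def)
  moreover have "t \<otimes> y = y \<otimes> t"
    using comm_commute(2)[of "comm z x" y] by (simp add: t_def triple_comm_rotate[of z x y, symmetric] triple_comm_rotate[of x y z, symmetric])
  ultimately have conj: "conj g (inv t) = inv t" if "g \<in> {x, y, z}" for g
    using that inv_commute[of t g] by (auto simp: conj_def m_assoc simp flip: inv_commute)
  have gen: "comm a (comm (inv b) c) = comm (comm b c) a"
    if "a \<in> carrier G" "b \<in> carrier G" "c \<in> carrier G" for a b c
    using that by (simp add: comm_inv_left comm_inv_right[of a "comm b c"] inv_comm[of a "comm b c"])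
  have "comm y (comm (inv x) z) = inv t"
    by (simp add: gen t_def triple_comm_swap_right[of x y z])
  moreover have "comm x (comm (inv z) y) = inv t"
    by (simp add: gen t_def triple_comm_swap_left[of y z x] triple_comm_rotate[of x y z])
  moreover have "comm z (comm (inv y) x) = inv t"
    by (simp add: gen t_def triple_comm_swap_left[of x y z])
  ultimately have "inv t \<otimes> inv t \<otimes> inv t = \<one>"
    using hall_witt[of x y z] by (simp add: conj)
  then have "inv (t [^] (3::nat)) = \<one>"
    by (simp add: numeral_3_eq_3 group_word)
  then show ?thesis
    by (metis \<open>t \<in> carrier G\<close> inv_inv inv_one nat_pow_closed t_def)
qed

end

section \<open>Finite p-groups and their endomorphisms\<close>

text \<open>Two values over the same \<open>g\<close>, multiplied by a value over
  \<open>inv g\<close>, both land over the identity, where only one value is allowed. So a relation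
  built from non-unique coordinates needs checking only on expressions for the identity.\<close>

lemma (in group) hom_of_graph:
  assumes sub: "R \<subseteq> carrier G \<times> carrier G"
    and mult: "\<And>a b c d. (a, b) \<in> R \<Longrightarrow> (c, d) \<in> R \<Longrightarrow> (a \<otimes> c, b \<otimes> d) \<in> R"
    and total: "\<And>g. g \<in> carrier G \<Longrightarrow> \<exists>h. (g, h) \<in> R"
    and one: "\<And>h. (\<one>, h) \<in> R \<Longrightarrow> h = \<one>"
  obtains f where "f \<in> hom G G" "\<And>g h. (g, h) \<in> R \<Longrightarrow> f g = h"
proof -
  have unique: "h = h'" if R: "(g, h) \<in> R" "(g, h') \<in> R" for g h h'
  proof -
    have [simp]: "g \<in> carrier G" "h \<in> carrier G" "h' \<in> carrier G" using R sub by auto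
    obtain k where k: "(inv g, k) \<in> R" using total[of "inv g"] by auto
    then have [simp]: "k \<in> carrier G" using sub by auto
    have "k \<otimes> h = \<one>" "k \<otimes> h' = \<one>"
      using mult[OF k R(1)] mult[OF k R(2)] by (auto intro: one)
    then have "k \<otimes> h = k \<otimes> h'" by simp
    then show ?thesis by simp
  qed
  define f where "f g = (SOME h. (g, h) \<in> R)" for g
  have fR: "(g, f g) \<in> R" if "g \<in> carrier G" for g
    unfolding f_def using total[OF that] by (rule someI_ex)
  have f: "f g = h" if "(g, h) \<in> R" for g h
    using unique[OF fR that] that sub by auto
  show ?thesis
  proof
    show "f \<in> hom G G"
    proof (rule homI)
      fix x y assume xy: "x \<in> carrier G" "y \<in> carrier G"
      show "f x \<in> carrier G" using fR[OF xy(1)] sub by auto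
      show "f (x \<otimes> y) = f x \<otimes> f y"
        by (rule f, rule mult[OF fR[OF xy(1)] fR[OF xy(2)]])
    qed
  qed (rule f)
qed

text \<open>The explicit product set is the subgroup generated by \<open>H\<close> and
  \<open>g\<close> once \<open>H\<close> contains the derived subgroup
  (\<open>adjoin_subgroup\<close>). In this form its members come with coordinates, on which the
  later normal forms rest.\<close>

definition (in group) adjoin :: "'a set \<Rightarrow> 'a \<Rightarrow> 'a set" where
  "adjoin H g = (\<lambda>(h, i::int). h \<otimes> g [^] i) ` (H \<times> UNIV)"

context group begin

lemma adjoinI: "h \<in> H \<Longrightarrow> h \<otimes> g [^] (i::int) \<in> adjoin H g"
  unfolding adjoin_def by (rule image_eqI[of _ _ "(h, i)"]) auto

lemma adjoinE:
  assumes "x \<in> adjoin H g"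
  obtains h i where "h \<in> H" "x = h \<otimes> g [^] (i::int)"
  using assms unfolding adjoin_def by auto

lemma subset_adjoin: "H \<subseteq> carrier G \<Longrightarrow> H \<subseteq> adjoin H g"
  using adjoinI[of _ H g 0] by fastforce

lemma mem_adjoin: "subgroup H G \<Longrightarrow> g \<in> carrier G \<Longrightarrow> g \<in> adjoin H g"
  using adjoinI[of \<one> H g 1] by (simp add: subgroup.one_closed)

lemma conj_mem_subgroup:
  assumes "subgroup H G" "derived G (carrier G) \<subseteq> H" "h \<in> H" "g \<in> carrier G"
  shows "g \<otimes> h \<otimes> inv g \<in> H"
proof -
  have h: "h \<in> carrier G" using assms(1,3) by (rule subgroup.mem_carrier)
  have "g \<otimes> h \<otimes> inv g = comm g h \<otimes> h"
    using h assms(4) by (simp add: comm_def m_assoc)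
  moreover have "comm g h \<in> H" using assms(2) comm_in_derived[OF assms(4) h] by auto
  ultimately show ?thesis using subgroup.m_closed[OF assms(1)] assms(3) by simp
qed

lemma adjoin_subgroup:
  assumes H: "subgroup H G" and D: "derived G (carrier G) \<subseteq> H" and [simp]: "g \<in> carrier G"
  shows "subgroup (adjoin H g) G"
proof -
  have Hc [simp]: "h \<in> carrier G" if "h \<in> H" for h
    by (rule subgroup.mem_carrier[OF H that])
  have mult: "a \<otimes> b \<in> adjoin H g" if ab: "a \<in> adjoin H g" "b \<in> adjoin H g" for a b
  proof -
    obtain h i where [simp]: "h \<in> H" and a: "a = h \<otimes> g [^] (i::int)" using ab(1) by (rule adjoinE)
    obtain k j where [simp]: "k \<in> H" and b: "b = k \<otimes> g [^] (j::int)" using ab(2) by (rule adjoinE)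
    have "a \<otimes> b = (h \<otimes> (g [^] i \<otimes> k \<otimes> inv (g [^] i))) \<otimes> g [^] (i + j)"
      unfolding a b by (simp add: int_pow_mult m_assoc)
    moreover have "h \<otimes> (g [^] i \<otimes> k \<otimes> inv (g [^] i)) \<in> H"
      by (intro subgroup.m_closed[OF H] conj_mem_subgroup[OF H D]) simp_all
    ultimately show ?thesis by (simp add: adjoinI)
  qed
  show ?thesis
  proof (rule subgroupI)
    show "adjoin H g \<subseteq> carrier G" by (auto elim!: adjoinE)
    show "adjoin H g \<noteq> {}" using mem_adjoin[OF H, of g] by auto
    fix a assume "a \<in> adjoin H g"
    then obtain h i where [simp]: "h \<in> H" and a: "a = h \<otimes> g [^] (i::int)" by (elim adjoinE)
    have "\<one> \<otimes> g [^] (- i) \<in> adjoin H g" by (rule adjoinI) (simp add: H subgroup.one_closed)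
    moreover have "inv h \<otimes> g [^] (0::int) \<in> adjoin H g"
      by (rule adjoinI) (simp add: H subgroup.m_inv_closed)
    ultimately have "(\<one> \<otimes> g [^] (- i)) \<otimes> (inv h \<otimes> g [^] (0::int)) \<in> adjoin H g" by (rule mult)
    then show "inv a \<in> adjoin H g" by (simp add: a int_pow_neg inv_mult_group)
  qed (rule mult)
qed

end

locale finite_p_group = group G for G (structure) +
  fixes p :: nat
  assumes prime_p: "Factorial_Ring.prime p"
    and fin: "finite (carrier G)"
    and ord_prime_power: "x \<in> carrier G \<Longrightarrow> \<exists>k. ord x = p ^ k"
begin

lemma p_gt_1: "p > 1" using prime_p by (rule prime_gt_1_nat)

lemma eq_one_if_coprime_pow:
  assumes "x \<in> carrier G" "x [^] (n::int) = \<one>" "\<not> int p dvd n"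
  shows "x = \<one>"
proof -
  obtain k where k: "ord x = p ^ k" using ord_prime_power[OF assms(1)] by blast
  have "int (p ^ k) dvd n" using assms int_pow_eq_id k by auto
  with assms(3) have "k = 0" by (cases k) (auto simp: dvd_mult_left)
  with k assms(1) ord_eq_1 show ?thesis by auto
qed

text \<open>A prime \<open>r\<close> dividing the order yields a subgroup of order \<open>r\<close>
  by Sylow. A nontrivial \<open>h\<close> in it satisfies \<open>h^r = 1\<close> and has order a
  power of \<open>p\<close>, so \<open>r = p\<close>.\<close>

lemma order_prime_power: "\<exists>n. order G = p ^ n"
proof -
  have pos: "order G > 0" using fin by (simp add: order_gt_0_iff_finite)
  have "r = p" if r: "Factorial_Ring.prime r" "r dvd order G" for r
  proof -
    obtain m where "order G = r ^ 1 * m" using r by auto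
    then obtain H where H: "subgroup H G" "card H = r"
      using sylow_thm[OF r(1) is_group _ fin, of 1 m] by auto
    have "card H > 1" using H r prime_gt_1_nat by simp
    have "\<exists>h\<in>H. h \<noteq> \<one>"
    proof (rule ccontr)
      assume "\<not> ?thesis"
      then have "H \<subseteq> {\<one>}" by blast
      then have "card H \<le> 1" using card_mono[of "{\<one>}" H] by simp
      with \<open>card H > 1\<close> show False by simp
    qed
    then obtain h where h: "h \<in> H" "h \<noteq> \<one>" by blast
    have hc: "h \<in> carrier G" by (rule subgroup.mem_carrier[OF H(1) h(1)])
    interpret H: group "G\<lparr>carrier := H\<rparr>" by (rule subgroup_imp_group[OF H(1)])
    have "h [^]\<^bsub>G\<lparr>carrier := H\<rparr>\<^esub> order (G\<lparr>carrier := H\<rparr>) = \<one>\<^bsub>G\<lparr>carrier := H\<rparr>\<^esub>"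
      by (rule H.pow_order_eq_1) (simp add: h)
    then have "h [^] r = \<one>"
      using H by (simp add: order_def nat_pow_consistent[symmetric])
    then have "h [^] int r = \<one>" by (simp add: int_pow_int)
    with eq_one_if_coprime_pow[OF hc, of "int r"] h have "p dvd r" by auto
    with r(1) prime_p show ?thesis using primes_dvd_imp_eq by blast
  qed
  note only_p = this
  have "order G \<noteq> 0" "\<not> is_unit p" using pos p_gt_1 by auto
  then obtain r where r: "order G = p ^ multiplicity p (order G) * r" "\<not> p dvd r"
    by (rule multiplicity_decompose')
  have "r = 1"
  proof (rule ccontr)
    assume "r \<noteq> 1"
    then obtain s where s: "Factorial_Ring.prime s" "s dvd r" using prime_factor_nat by blast
    then have "s = p" using only_p r(1) by (metis dvd_mult)
    with s r show False by simp
  qed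
  with r show ?thesis by auto
qed

lemma card_subgroup:
  assumes "subgroup H G" shows "\<exists>k. card H = p ^ k"
proof -
  have "card H dvd order G" using lagrange[OF assms] by (metis dvd_triv_right)
  then show ?thesis
    using order_prime_power divides_primepow_nat[OF prime_p] by auto
qed

lemma finite_subgroup: "subgroup H G \<Longrightarrow> finite H"
  using fin finite_subset subgroup.subset by blast

text \<open>Subgroup orders are powers of \<open>p\<close>, so a strict inclusion gains at least a
  factor \<open>p\<close>. The estimates along chains of subgroups below all rest on this.\<close>

lemma card_proper_subgroup:
  assumes "subgroup H G" "subgroup K G" "H \<subseteq> K" "g \<in> K" "g \<notin> H"
  shows "p * card H \<le> card K"
proof -
  obtain h k where hk: "card H = p ^ h" "card K = p ^ k" using assms card_subgroup by blast
  have "card H < card K"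
    using assms by (intro psubset_card_mono finite_subgroup) auto
  then have "h < k" using hk p_gt_1 by simp
  then have "p ^ Suc h \<le> p ^ k" using p_gt_1 by (intro power_increasing) auto
  then show ?thesis using hk by simp
qed

lemma card_adjoin:
  assumes "subgroup H G" "derived G (carrier G) \<subseteq> H" "g \<in> carrier G" "g \<notin> H"
  shows "p * card H \<le> card (adjoin H g)"
  using assms by (intro card_proper_subgroup[of H _ g] adjoin_subgroup subset_adjoin mem_adjoin)
    (auto simp: subgroup.subset)

end

text \<open>\<open>N\<close> is a complement of the cyclic group generated by an element
  \<open>a\<close> of maximal order: the quotient by \<open>N\<close> is cyclic of order
  \<open>p^e\<close>, generated by the image of \<open>a\<close>. This replaces the basis theorem
  for finite abelian groups.\<close>

lemma (in comm_group) cyclic_quotient: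
  fixes p e :: nat
  assumes p: "Factorial_Ring.prime p" and fin: "finite (carrier G)" and e: "e > 0"
    and expo: "\<And>x. x \<in> carrier G \<Longrightarrow> x [^] int (p ^ e) = \<one>"
    and a [simp]: "a \<in> carrier G" and ne: "a [^] int (p ^ (e - 1)) \<noteq> \<one>"
  obtains N where "subgroup N G" "\<And>x. x \<in> carrier G \<Longrightarrow> x \<in> adjoin N a"
    "\<And>n::int. a [^] n \<in> N \<Longrightarrow> int (p ^ e) dvd n"
proof -
  define s where "s = a [^] int (p ^ (e - 1))"
  \<comment> \<open>\<open>s\<close> lies in every nontrivial subgroup of the cyclic group generated
    by \<open>a\<close>, so avoiding \<open>s\<close> means meeting that group trivially. A maximal
    such \<open>N\<close> is the complement.\<close>
  let ?F = "{N. subgroup N G \<and> s \<notin> N}"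
  have "{\<one>} \<in> ?F" using ne by (simp add: s_def triv_subgroup)
  moreover have "finite ?F"
    by (rule finite_subset[of _ "Pow (carrier G)"]) (auto simp: fin dest: subgroup.subset)
  ultimately obtain N where N: "N \<in> ?F" and max: "\<And>M. M \<in> ?F \<Longrightarrow> N \<subseteq> M \<Longrightarrow> N = M"
    using finite_has_maximal[of ?F] by blast
  have sub: "subgroup N G" and sN: "s \<notin> N" using N by auto
  have D: "derived G (carrier G) \<subseteq> N"
    using derived_eq_singleton[of "carrier G"] subgroup.one_closed[OF sub] by simp
  note adjoin_sub = adjoin_subgroup[OF sub D]
  have Nc [simp]: "x \<in> carrier G" if "x \<in> N" for x
    by (rule subgroup.mem_carrier[OF sub that])
  have N_sub: "N \<subseteq> adjoin N y" for y
    by (rule subset_adjoin[OF subgroup.subset[OF sub]])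
  have s_adjoin: "s \<in> adjoin N y" if y: "y \<in> carrier G" "y \<notin> N" for y
  proof (rule ccontr)
    assume "s \<notin> adjoin N y"
    then have "N = adjoin N y" using adjoin_sub[OF y(1)] N_sub by (intro max) auto
    with mem_adjoin[OF sub y(1)] y(2) show False by auto
  qed
  \<comment> \<open>Otherwise \<open>gcd n (p^e) = p^k\<close> with \<open>k < e\<close>; by Bezout
    \<open>a^(p^k)\<close> is in \<open>N\<close>, and so is its power \<open>s\<close>.\<close>
  have dvd: "int (p ^ e) dvd n" if n: "a [^] n \<in> N" for n :: int
  proof (rule ccontr)
    assume nd: "\<not> int (p ^ e) dvd n"
    have "gcd n (int (p ^ e)) dvd int p ^ e" by simp
    then have "nat (gcd n (int (p ^ e))) dvd p ^ e"
      by (simp add: nat_dvd_iff)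
    then obtain k where k: "k \<le> e" "nat (gcd n (int (p ^ e))) = p ^ k"
      using divides_primepow_nat[OF p] by blast
    then have k': "gcd n (int (p ^ e)) = int (p ^ k)"
      by (metis gcd_ge_0_int int_nat_eq)
    have "k \<noteq> e" using nd k' by (metis gcd_dvd1)
    with k have ke: "e - 1 = k + (e - 1 - k)" by linarith
    obtain u v where "u * n + v * int (p ^ e) = int (p ^ k)"
      using bezout_int[of n "int (p ^ e)"] k' by metis
    then have "a [^] int (p ^ k) = a [^] (n * u + int (p ^ e) * v)" by (simp add: mult.commute)
    also have "\<dots> = (a [^] n) [^] u \<otimes> (a [^] int (p ^ e)) [^] v"
      unfolding int_pow_mult[OF a] int_pow_pow[OF a] ..
    also have "\<dots> = (a [^] n) [^] u"
      unfolding expo[OF a] by simp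
    also have "\<dots> \<in> N" by (rule subgroup_int_pow_closed[OF sub n])
    finally have "(a [^] int (p ^ k)) [^] int (p ^ (e - 1 - k)) \<in> N"
      by (rule subgroup_int_pow_closed[OF sub])
    moreover have "(a [^] int (p ^ k)) [^] int (p ^ (e - 1 - k)) = s"
      unfolding s_def int_pow_pow[OF a] using ke by (metis of_nat_mult power_add)
    ultimately show False using sN by simp
  qed
  let ?K = "adjoin N a"
  have K: "subgroup ?K G" by (rule adjoin_sub) simp
  have sK: "s \<in> ?K" unfolding s_def by (rule subgroup_int_pow_closed[OF K mem_adjoin[OF sub a]])
  \<comment> \<open>Replace \<open>x\<close> by its last \<open>p\<close>-power \<open>x'\<close>
    outside \<open>?K\<close>, so that \<open>x'^p = n a^i\<close>. The exponent \<open>p^e\<close>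
    forces \<open>p\<close> to divide \<open>i\<close>, and dividing \<open>x'\<close> by a power of
    \<open>a\<close> gives \<open>y\<close> outside \<open>?K\<close> with \<open>y^p\<close> in
    \<open>N\<close>. Maximality of \<open>N\<close> puts \<open>s\<close> into
    \<open>adjoin N y\<close>, so a power \<open>y^k\<close> with \<open>k\<close> prime to
    \<open>p\<close> lies in \<open>?K\<close>; together with \<open>y^p\<close> this gives
    \<open>y\<close> itself.\<close>
  have all: "x \<in> ?K" if x: "x \<in> carrier G" for x
  proof (rule ccontr)
    assume xK: "x \<notin> ?K"
    have "\<exists>j. x [^] int (p ^ j) \<in> ?K"
      by (rule exI[of _ e]) (simp only: expo[OF x] subgroup.one_closed[OF K])
    then obtain j where j: "x [^] int (p ^ j) \<in> ?K" "\<And>i. i < j \<Longrightarrow> x [^] int (p ^ i) \<notin> ?K"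
      using exists_least_iff[of "\<lambda>j. x [^] int (p ^ j) \<in> ?K"] by blast
    have "j \<noteq> 0"
    proof
      assume "j = 0"
      with xK j(1) x show False by simp
    qed
    define x' where "x' = x [^] int (p ^ (j - 1))"
    have [simp]: "x' \<in> carrier G" using x by (simp add: x'_def)
    have x'K: "x' \<notin> ?K" using j(2)[of "j - 1"] \<open>j \<noteq> 0\<close> by (simp add: x'_def)
    have "x' [^] int p = x [^] int (p ^ j)"
      using \<open>j \<noteq> 0\<close> unfolding x'_def int_pow_pow[OF x] by (cases j) (simp_all add: mult.commute)
    then have "x' [^] int p \<in> ?K" using j(1) by simp
    then obtain n i where nN: "n \<in> N" and x'p: "x' [^] int p = n \<otimes> a [^] (i::int)" by (rule adjoinE)
    note [simp] = Nc[OF nN]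
    have e': "int p * int (p ^ (e - 1)) = int (p ^ e)" using e by (cases e) simp_all
    have "n [^] int (p ^ (e - 1)) \<otimes> a [^] (i * int (p ^ (e - 1))) = (x' [^] int p) [^] int (p ^ (e - 1))"
      by (simp add: x'p int_pow_distrib int_pow_pow)
    also have "\<dots> = \<one>" by (simp only: int_pow_pow[OF \<open>x' \<in> carrier G\<close>] e' expo[OF \<open>x' \<in> carrier G\<close>])
    finally have "inv (n [^] int (p ^ (e - 1))) = a [^] (i * int (p ^ (e - 1)))"
      by (simp add: inv_equality m_comm)
    moreover have "inv (n [^] int (p ^ (e - 1))) \<in> N"
      by (intro subgroup.m_inv_closed[OF sub] subgroup_int_pow_closed[OF sub nN])
    ultimately have "int (p ^ e) dvd i * int (p ^ (e - 1))" by (intro dvd) simp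
    then have "int p * int (p ^ (e - 1)) dvd i * int (p ^ (e - 1))" by (simp only: e')
    then have "int p dvd i"
      by (rule dvd_mult_cancel_right[THEN iffD1, THEN disjE]) (use p in \<open>auto simp: prime_gt_0_nat\<close>)
    then obtain j' where i: "i = j' * int p" by (metis dvd_def mult.commute)
    define y where "y = x' \<otimes> inv (a [^] j')"
    have [simp]: "y \<in> carrier G" by (simp add: y_def)
    have x'_y: "x' = y \<otimes> a [^] j'" by (simp add: y_def m_assoc)
    have yK: "y \<notin> ?K"
    proof
      assume "y \<in> ?K"
      then have "y \<otimes> a [^] j' \<in> ?K"
        by (intro subgroup.m_closed[OF K] subgroup_int_pow_closed[OF K mem_adjoin[OF sub a]])
      with x'K x'_y show False by simp
    qed
    have "y [^] int p \<otimes> a [^] i = n \<otimes> a [^] i"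
      unfolding x'p[symmetric] by (simp add: x'_y int_pow_distrib int_pow_pow i)
    then have yp: "y [^] int p \<in> N" using nN by simp
    have "y \<notin> N" using yK N_sub by auto
    then obtain n' k where n': "n' \<in> N" and sk: "s = n' \<otimes> y [^] (k::int)"
      using s_adjoin[OF \<open>y \<in> carrier G\<close>] by (blast elim: adjoinE)
    note [simp] = Nc[OF n']
    have yk: "y [^] k = inv n' \<otimes> s" by (simp add: sk)
    have "\<not> int p dvd k"
    proof
      assume "int p dvd k"
      then obtain k' where "k = int p * k'" by (elim dvdE)
      then have "y [^] k = (y [^] int p) [^] k'" by (simp add: int_pow_pow)
      then have "y [^] k \<in> N" using subgroup_int_pow_closed[OF sub yp] by simp
      then have "s \<in> N" unfolding sk by (rule subgroup.m_closed[OF sub n'])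
      with sN show False by simp
    qed
    then have "coprime (int p) k"
      using p by (intro prime_imp_coprime) simp_all
    then obtain u v where uv: "u * int p + v * k = 1"
      using bezout_int[of "int p" k] by (metis coprime_iff_gcd_eq_1)
    have ypK: "y [^] int p \<in> ?K" using yp N_sub by auto
    have "n' \<in> ?K" using n' N_sub by auto
    then have ykK: "y [^] k \<in> ?K"
      unfolding yk by (intro subgroup.m_closed[OF K] subgroup.m_inv_closed[OF K] sK)
    have "y = y [^] (int p * u + k * v)" using uv by (simp add: mult.commute)
    also have "\<dots> = (y [^] int p) [^] u \<otimes> (y [^] k) [^] v"
      by (simp add: int_pow_mult int_pow_pow)
    also have "\<dots> \<in> ?K"
      by (intro subgroup.m_closed[OF K] subgroup_int_pow_closed[OF K ypK] subgroup_int_pow_closed[OF K ykK])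
    finally show False using yK by simp
  qed
  show ?thesis by (rule that[OF sub all dvd])
qed


locale finite_pE_group = finite_p_group +
  assumes E: "f \<in> hom G G \<Longrightarrow> x \<in> carrier G \<Longrightarrow> x \<otimes> f x = f x \<otimes> x"

sublocale finite_pE_group \<subseteq> two_engel
proof
  fix x g assume [simp]: "x \<in> carrier G" "g \<in> carrier G"
  have "conj g \<in> hom G G" by (auto simp: hom_def conj_mult)
  then show "x \<otimes> conj g x = conj g x \<otimes> x" by (rule E) simp
qed

context finite_pE_group begin

text \<open>If \<open>G/D\<close> has a cyclic quotient of order \<open>p\<^sup>e\<close> generated by the image of \<open>a\<close>, then for every \<open>z\<close>
  with \<open>z ^ p\<^sup>e = 1\<close> there is an endomorphism that sends \<open>a\<close> to \<open>z\<close> and kills the kernel.\<close>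
lemma derived_exponent:
  obtains e where "\<And>x. x \<in> carrier G \<Longrightarrow> x [^] int (p ^ e) \<in> derived G (carrier G)"
    "\<And>x. x \<in> carrier G \<Longrightarrow> x [^] int (p ^ e) = \<one> \<Longrightarrow> x \<in> centre"
    "e = 0 \<Longrightarrow> derived G (carrier G) = carrier G"
proof -
  let ?D = "derived G (carrier G)"
  let ?P = "\<lambda>e. \<forall>x\<in>carrier G. x [^] int (p ^ e) \<in> ?D"
  obtain n where n: "order G = p ^ n" using order_prime_power by blast
  have "x [^] int (p ^ n) = \<one>" if "x \<in> carrier G" for x
    using pow_order_eq_1[OF that] n by (simp add: int_pow_int del: of_nat_power)
  then have "?P n" by (simp add: subgroup.one_closed[OF derived_subgroup])
  \<comment> \<open>For \<open>e > 0\<close>, minimality supplies the element \<open>a\<close> of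
    maximal order in the quotient. For \<open>e = 0\<close> the group is perfect and there is no
    such \<open>a\<close>; this case is passed on to be refuted where the lemma is applied.\<close>
  then obtain e where e: "?P e" "\<And>i. i < e \<Longrightarrow> \<not> ?P i"
    using exists_least_iff[of ?P] by blast
  show ?thesis
  proof (cases "e = 0")
    case True
    then have "x \<in> ?D" if "x \<in> carrier G" for x using e(1) that by auto
    then have D: "?D = carrier G" by auto
    show ?thesis
    proof (rule that[of e])
      fix x assume "x \<in> carrier G" "x [^] int (p ^ e) = \<one>"
      then have "x = \<one>" using True by simp
      then show "x \<in> centre" by (simp add: subgroup.one_closed[OF centre_subgroup])
    qed (use e(1) D in auto)
  next
    case False
    then obtain a where a [simp]: "a \<in> carrier G" and aD: "a [^] int (p ^ (e - 1)) \<notin> ?D"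
      using e(2)[of "e - 1"] by auto
    interpret D: normal ?D G by (rule derived_self_is_normal)
    interpret Q: comm_group "G Mod ?D" by (rule derived_quot_is_comm_group)
    define q where "q x = ?D #> x" for x
    have q_hom: "q \<in> hom G (G Mod ?D)" unfolding q_def by (rule D.r_coset_hom_Mod)
    interpret q: group_hom G "G Mod ?D" q by unfold_locales (rule q_hom)
    have q_pow: "q x [^]\<^bsub>G Mod ?D\<^esub> (i::int) = q (x [^] i)" if "x \<in> carrier G" for x i
      using q.hom_int_pow[OF that, of i] by simp
    have q_one: "q x = \<one>\<^bsub>G Mod ?D\<^esub> \<longleftrightarrow> x \<in> ?D" if "x \<in> carrier G" for x
      using that coset_join1[of ?D x] coset_join2[of x ?D] derived_subgroup subgroup.subset[OF derived_subgroup]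
      by (auto simp: q_def FactGroup_def)
    have q_surj: "\<exists>x\<in>carrier G. y = q x" if "y \<in> carrier (G Mod ?D)" for y
      using that by (auto simp: q_def FactGroup_def RCOSETS_def)
    have finQ: "finite (carrier (G Mod ?D))"
      by (rule finite_subset[of _ "q ` carrier G"]) (use q_surj fin in auto)
    obtain N where N: "subgroup N (G Mod ?D)"
      and all: "\<And>x. x \<in> carrier (G Mod ?D) \<Longrightarrow> x \<in> Q.adjoin N (q a)"
      and dvd: "\<And>n::int. q a [^]\<^bsub>G Mod ?D\<^esub> n \<in> N \<Longrightarrow> int (p ^ e) dvd n"
    proof (rule Q.cyclic_quotient[OF prime_p finQ, of e "q a"])
      show "e > 0" using False by simp
      show "q a \<in> carrier (G Mod ?D)" by simp
      show "q a [^]\<^bsub>G Mod ?D\<^esub> int (p ^ (e - 1)) \<noteq> \<one>\<^bsub>G Mod ?D\<^esub>"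
        using aD q_one[of "a [^] int (p ^ (e - 1))"] by (simp add: q_pow)
    next
      fix y assume "y \<in> carrier (G Mod ?D)"
      then obtain x where "x \<in> carrier G" "y = q x" using q_surj by blast
      then show "y [^]\<^bsub>G Mod ?D\<^esub> int (p ^ e) = \<one>\<^bsub>G Mod ?D\<^esub>"
        using e(1) q_one[of "x [^] int (p ^ e)"] by (simp add: q_pow)
    qed (rule that)
    have central: "z \<in> centre" if [simp]: "z \<in> carrier G" and z: "z [^] int (p ^ e) = \<one>" for z
    proof -
      \<comment> \<open>The graph of the map that writes \<open>x\<close> as an element of the
        preimage of \<open>N\<close> times \<open>a^n\<close> and sends it to \<open>z^n\<close>.
        The exponent \<open>n\<close> is determined modulo \<open>p^e\<close> only, whence the
        condition on \<open>z\<close>.\<close>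
      let ?R = "{(x, z [^] n) | x n. x \<in> carrier G \<and> q (x \<otimes> inv (a [^] (n::int))) \<in> N}"
      obtain f where f: "f \<in> hom G G" "\<And>g h. (g, h) \<in> ?R \<Longrightarrow> f g = h"
      proof (rule hom_of_graph[of ?R])
        show "?R \<subseteq> carrier G \<times> carrier G" by auto
      next
        fix x1 y1 x2 y2 assume "(x1, y1) \<in> ?R" "(x2, y2) \<in> ?R"
        then obtain n1 n2 :: int where [simp]: "x1 \<in> carrier G" "x2 \<in> carrier G"
          and y: "y1 = z [^] n1" "y2 = z [^] n2"
          and qN: "q (x1 \<otimes> inv (a [^] n1)) \<in> N" "q (x2 \<otimes> inv (a [^] n2)) \<in> N"
          by auto
        have "q (x1 \<otimes> inv (a [^] n1)) \<otimes>\<^bsub>G Mod ?D\<^esub> q (x2 \<otimes> inv (a [^] n2)) \<in> N"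
          using qN by (rule subgroup.m_closed[OF N])
        also have "q (x1 \<otimes> inv (a [^] n1)) \<otimes>\<^bsub>G Mod ?D\<^esub> q (x2 \<otimes> inv (a [^] n2)) = q ((x1 \<otimes> x2) \<otimes> inv (a [^] (n1 + n2)))"
          by (simp add: int_pow_mult Q.m_ac Q.inv_mult inv_mult_group del: mult_FactGroup)
        finally have "q ((x1 \<otimes> x2) \<otimes> inv (a [^] (n1 + n2))) \<in> N" .
        moreover have "x1 \<otimes> x2 \<in> carrier G" by simp
        ultimately have "(x1 \<otimes> x2, z [^] (n1 + n2)) \<in> ?R" by blast
        then show "(x1 \<otimes> x2, y1 \<otimes> y2) \<in> ?R" by (simp only: y int_pow_mult[OF \<open>z \<in> carrier G\<close>])
      next
        fix g assume [simp]: "g \<in> carrier G"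
        have "q g \<in> Q.adjoin N (q a)" by (rule all) simp
        then obtain h n where h: "h \<in> N" "q g = h \<otimes>\<^bsub>G Mod ?D\<^esub> q a [^]\<^bsub>G Mod ?D\<^esub> (n::int)"
          by (rule Q.adjoinE)
        have hc: "h \<in> carrier (G Mod ?D)" by (rule subgroup.mem_carrier[OF N h(1)])
        have "q (g \<otimes> inv (a [^] n)) = h"
          using hc by (simp add: h(2) q_pow Q.m_assoc del: mult_FactGroup one_FactGroup)
        then have "q (g \<otimes> inv (a [^] n)) \<in> N" using h(1) by (simp only:)
        then show "\<exists>h. (g, h) \<in> ?R" using \<open>g \<in> carrier G\<close> by blast
      next
        fix h assume "(\<one>, h) \<in> ?R"
        then obtain n :: int where h: "h = z [^] n" and "q (\<one> \<otimes> inv (a [^] n)) \<in> N" by auto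
        then have "q (a [^] (- n)) \<in> N" by (simp add: int_pow_neg)
        then have "int (p ^ e) dvd - n" using dvd[of "- n"] by (simp add: q_pow)
        then obtain m where "n = int (p ^ e) * m" by (auto elim: dvdE)
        then have "h = (z [^] int (p ^ e)) [^] m" by (simp add: h int_pow_pow)
        then show "h = \<one>" by (simp only: z int_pow_one)
      qed (rule that)
      have one_N: "\<one>\<^bsub>G Mod ?D\<^esub> \<in> N" by (rule subgroup.one_closed[OF N])
      have fR: "f g = z [^] (n::int)" if "g \<in> carrier G" "q (g \<otimes> inv (a [^] n)) \<in> N" for g n
        using that by (intro f(2)) blast
      \<comment> \<open>Exponent 1: all of the coset of \<open>a\<close> is sent to \<open>z\<close>
        itself, so the E-condition makes the whole coset commute with \<open>z\<close>. This coset
        generates the group, since \<open>y = (y a) a^-1\<close> for \<open>y\<close> in the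
        preimage of \<open>N\<close>.\<close>
      have com: "g \<otimes> z = z \<otimes> g" if "g \<in> carrier G" "q (g \<otimes> inv (a [^] (1::int))) \<in> N" for g
        using E[OF f(1) that(1)] fR[OF that] by simp
      have az: "a \<in> centralizer z"
        using com[of a] one_N by (simp add: centralizer_def)
      have "x \<in> centralizer z" if [simp]: "x \<in> carrier G" for x
      proof -
        have "q x \<in> Q.adjoin N (q a)" by (rule all) simp
        then obtain h n where h: "h \<in> N" "q x = h \<otimes>\<^bsub>G Mod ?D\<^esub> q a [^]\<^bsub>G Mod ?D\<^esub> (n::int)"
          by (rule Q.adjoinE)
        have hc: "h \<in> carrier (G Mod ?D)" by (rule subgroup.mem_carrier[OF N h(1)])
        define y where "y = x \<otimes> inv (a [^] n)"
        have [simp]: "y \<in> carrier G" by (simp add: y_def)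
        have qy: "q y = h" using hc by (simp add: y_def h(2) q_pow Q.m_assoc del: mult_FactGroup one_FactGroup)
        have "q (y \<otimes> a \<otimes> inv (a [^] (1::int))) \<in> N" using h(1) qy by (simp add: m_assoc)
        then have ya: "y \<otimes> a \<in> centralizer z" using com[of "y \<otimes> a"] by (simp add: centralizer_def)
        have C: "subgroup (centralizer z) G" by (rule centralizer_subgroup) simp
        have "(y \<otimes> a \<otimes> inv a) \<otimes> a [^] n \<in> centralizer z"
          by (intro subgroup.m_closed[OF C subgroup.m_closed[OF C ya subgroup.m_inv_closed[OF C az]]]
              subgroup_int_pow_closed[OF C az])
        then show ?thesis by (simp add: y_def m_assoc)
      qed
      then show ?thesis unfolding centre_def centralizer_def by force
    qed
    show ?thesis by (rule that[of e]) (use e(1) False central in auto)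
  qed
qed

end

section \<open>Nilpotency class\<close>

lemma (in group) comm_int_pow_left:
  assumes [simp]: "x \<in> carrier G" "z \<in> carrier G" and c: "comm x z \<in> centre"
  shows "comm (x [^] (n::int)) z = comm x z [^] n"
proof -
  define c where "c = comm x z"
  have [simp]: "c \<in> carrier G" by (simp add: c_def)
  have "z \<otimes> x \<otimes> inv z = inv c \<otimes> x"
    by (simp add: c_def comm_def group_word)
  then have "z \<otimes> x [^] n \<otimes> inv z = (inv c \<otimes> x) [^] n"
    using conj_int_pow[of x z n] by simp
  also have "\<dots> = inv c [^] n \<otimes> x [^] n"
    using centre_commute[OF c, of x] by (intro int_pow_mult_distrib) (simp_all add: c_def inv_commute)
  finally have "z \<otimes> x [^] n \<otimes> inv z = inv (c [^] n) \<otimes> x [^] n"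
    by (simp add: int_pow_inv)
  moreover have "comm (x [^] n) z = x [^] n \<otimes> inv (z \<otimes> x [^] n \<otimes> inv z)"
    by (simp add: comm_def group_word)
  ultimately show ?thesis
    by (simp add: c_def inv_mult_group)
qed

context two_engel begin

text \<open>\<open>F\<close> changes to its inverse under each transposition of neighbours, hence is
  unchanged by the even permutation that takes \<open>a b c d\<close> to \<open>c d a b\<close>.
  Written as a commutator of two commutators, it is inverted by the same permutation.\<close>

lemma quadruple_comm_square:
  assumes [simp]: "a \<in> carrier G" "b \<in> carrier G" "c \<in> carrier G" "d \<in> carrier G"
  defines "F \<equiv> \<lambda>a b c d. comm (comm (comm a b) c) d"
  shows "F a b c d = comm (comm c d) (comm a b)" "F a b c d = inv (F a b c d)"
proof -
  have F: "F a b c d = comm (comm c d) (comm a b)"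
    if "a \<in> carrier G" "b \<in> carrier G" "c \<in> carrier G" "d \<in> carrier G" for a b c d
    using that by (simp add: F_def triple_comm_rotate)
  show "F a b c d = comm (comm c d) (comm a b)" by (rule F) simp_all
  have s12: "F b a c d = inv (F a b c d)" and s23: "F a c b d = inv (F a b c d)" and s34: "F a b d c = inv (F a b c d)"
    if "a \<in> carrier G" "b \<in> carrier G" "c \<in> carrier G" "d \<in> carrier G" for a b c d
    using that comm_inv_left[of "comm (comm a b) c" d]
    by (simp_all add: F_def triple_comm_swap_left[of a b c] triple_comm_swap_right[of a b c]
        triple_comm_swap_right[of "comm a b" c d])
  have "F c d a b = inv (F c a d b)" by (rule s23) simp_all
  also have "F c a d b = inv (F c a b d)" by (rule s34) simp_all
  also have "F c a b d = inv (F a c b d)" by (rule s12) simp_all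
  also have "F a c b d = inv (F a b c d)" by (rule s23) simp_all
  finally have "F c d a b = F a b c d" by (simp add: F_def)
  moreover have "F c d a b = inv (F a b c d)"
    using F[of c d a b] F[of a b c d] by (simp add: inv_comm)
  ultimately show "F a b c d = inv (F a b c d)" by simp
qed

text \<open>A fourfold commutator has square 1 by \<open>quadruple_comm_square\<close> and cube 1 as
  a triple commutator, so it is trivial.\<close>

lemma triple_comm_centre:
  assumes [simp]: "a \<in> carrier G" "b \<in> carrier G" "c \<in> carrier G"
  shows "comm (comm a b) c \<in> centre"
proof -
  have "comm (comm (comm a b) c) d = \<one>" if [simp]: "d \<in> carrier G" for d
  proof -
    define f where "f = comm (comm (comm a b) c) d"
    have [simp]: "f \<in> carrier G" by (simp add: f_def)
    have "f = inv f" using quadruple_comm_square(2)[of a b c d] by (simp add: f_def)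
    then have "f \<otimes> f = \<one>" by (metis \<open>f \<in> carrier G\<close> l_inv)
    moreover have "f \<otimes> f \<otimes> f = \<one>"
      using triple_comm_cube[of "comm a b" c d] by (simp add: f_def numeral_3_eq_3)
    ultimately show ?thesis by (simp add: f_def)
  qed
  then have "\<forall>d\<in>carrier G. comm (comm (comm a b) c) d = \<one>" by blast
  then show ?thesis unfolding centre_iff by simp
qed

lemma comm_comm_comm:
  assumes [simp]: "a \<in> carrier G" "b \<in> carrier G" "c \<in> carrier G" "d \<in> carrier G"
  shows "comm (comm a b) (comm c d) = \<one>"
proof -
  have "comm (comm a b) (comm c d) = comm (comm (comm c d) a) b"
    by (simp add: quadruple_comm_square(1))
  also have "\<dots> = \<one>"
    using triple_comm_centre[of c d a] by (simp add: centre_iff)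
  finally show ?thesis .
qed

lemma comm_comm_self:
  assumes [simp]: "x \<in> carrier G" "y \<in> carrier G"
  shows "comm (comm x y) x = \<one>" "comm (comm x y) y = \<one>"
    "comm x (comm x y) = \<one>" "comm y (comm x y) = \<one>"
  using comm_commute[of x y] by (simp_all add: comm_eq_one_iff)

end

lemma (in finite_p_group) card_centralizer_Int:
  assumes "subgroup K G" "g \<in> carrier G" "k \<in> K" "comm k g \<noteq> \<one>"
  shows "p * card (K \<inter> centralizer g) \<le> card K"
proof (rule card_proper_subgroup)
  have "k \<in> carrier G" by (rule subgroup.mem_carrier[OF assms(1,3)])
  then show "k \<notin> K \<inter> centralizer g"
    using assms by (auto simp: centralizer_iff)
qed (use assms in \<open>auto intro: subgroups_Inter_pair centralizer_subgroup\<close>)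

context finite_pE_group begin

text \<open>A nontrivial triple commutator forces \<open>p = 3\<close>, and then the successive centralizers of
  \<open>[y, z]\<close>, \<open>[x, z]\<close>, \<open>[x, y]\<close>, \<open>z\<close>, \<open>y\<close>, \<open>x\<close> form a strictly decreasing chain whose last member
  still contains the \<open>3\<^sup>e\<close>-th powers of these commutators.\<close>
lemma comm_in_centre:
  assumes small: "order G \<le> p ^ 7" and xy [simp]: "x \<in> carrier G" "y \<in> carrier G"
  shows "comm x y \<in> centre"
proof (rule ccontr)
  assume "comm x y \<notin> centre"
  then obtain z where [simp]: "z \<in> carrier G" and nz: "comm (comm x y) z \<noteq> \<one>"
    by (auto simp: centre_iff)
  define c v u t where defs: "c = comm x y" "v = comm x z" "u = comm y z" "t = comm c z"
  have [simp]: "c \<in> carrier G" "v \<in> carrier G" "u \<in> carrier G" "t \<in> carrier G" by (simp_all add: defs)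
  have t: "t \<noteq> \<one>" using nz by (simp add: defs)
  have t3: "t [^] (3::int) = \<one>"
    using triple_comm_cube[of x y z] int_pow_int[of G t 3] by (simp add: defs)
  have p3: "p = 3"
  proof -
    have "int p dvd int 3" using eq_one_if_coprime_pow[OF \<open>t \<in> carrier G\<close> t3] t by auto
    then have "p dvd 3" by (simp only: of_nat_dvd_iff)
    moreover have "p \<noteq> 2" using \<open>p dvd 3\<close> by auto
    ultimately show ?thesis using p_gt_1 dvd_imp_le[of p 3] by simp
  qed
  have vy: "comm v y = inv t" unfolding defs by (rule triple_comm_swap_right) simp_all
  have ux: "comm u x = t" unfolding defs by (rule triple_comm_rotate) simp_all
  obtain e where e: "\<And>x. x \<in> carrier G \<Longrightarrow> x [^] int (p ^ e) = \<one> \<Longrightarrow> x \<in> centre"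
    "e = 0 \<Longrightarrow> derived G (carrier G) = carrier G"
    by (rule derived_exponent) blast
  have "e \<noteq> 0"
  proof
    assume "e = 0"
    moreover have "derived G (carrier G) \<subseteq> centralizer c"
      by (rule derived_subset) (auto simp: centralizer_subgroup centralizer_iff defs comm_comm_comm)
    ultimately have "z \<in> centralizer c" using e(2) by auto
    with t show False using comm_swap_eq_one[of z c] by (simp add: defs centralizer_iff)
  qed
  define q where "q = int (p ^ e)"
  have q3: "3 dvd q" using \<open>e \<noteq> 0\<close> by (simp add: q_def p3)
  have tq: "t [^] q = \<one>"
    using q3 t3 by (elim dvdE) (simp add: int_pow_pow[symmetric])
  note central = triple_comm_centre
  define K6 where "K6 = (((((centralizer u \<inter> centralizer v) \<inter> centralizer c) \<inter> centralizer z) \<inter> centralizer y) \<inter> centralizer x)"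
  have cc: "comm a b \<in> centralizer (comm c d)" if "a \<in> carrier G" "b \<in> carrier G" "c \<in> carrier G" "d \<in> carrier G" for a b c d
    using that comm_comm_comm by (simp add: centralizer_iff)
  have c1: "x \<in> centralizer v" "x \<in> centralizer c" "y \<in> centralizer u" "y \<in> centralizer c" "z \<in> centralizer u" "z \<in> centralizer v"
    by (simp_all add: centralizer_iff defs comm_comm_self)
  have c2: "c \<in> centralizer x" "c \<in> centralizer y" "v \<in> centralizer x" "v \<in> centralizer z" "u \<in> centralizer y" "u \<in> centralizer z"
    by (simp_all add: centralizer_iff defs comm_comm_self)
  note subs = subgroups_Inter_pair centralizer_subgroup
  have inv_ne: "inv t \<noteq> \<one>" using t by (metis \<open>t \<in> carrier G\<close> inv_inv inv_one)
  have swap_ne: "comm h g \<noteq> \<one>" if "comm g h \<noteq> \<one>" "g \<in> carrier G" "h \<in> carrier G" for g h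
    using that comm_swap_eq_one by blast
  \<comment> \<open>The witnesses that the six inclusions are strict: \<open>u\<close> against
    \<open>x\<close>, \<open>v\<close> against \<open>y\<close>, \<open>c\<close> against
    \<open>z\<close>, and then the same pairs with the roles exchanged. Each pair has commutator
    \<open>t\<close> up to inversion, and every other commutator between them is trivial or is
    killed by \<open>comm_comm_comm\<close>.\<close>
  have "p * card K6 \<le> card ((((centralizer u \<inter> centralizer v) \<inter> centralizer c) \<inter> centralizer z) \<inter> centralizer y)"
    unfolding K6_def
    by (rule card_centralizer_Int[of _ x u]) (use c2 t ux in \<open>auto intro!: subs simp: cc defs\<close>)
  moreover have "p * \<dots> \<le> card (((centralizer u \<inter> centralizer v) \<inter> centralizer c) \<inter> centralizer z)"
    by (rule card_centralizer_Int[of _ y v]) (use c2 inv_ne vy in \<open>auto intro!: subs simp: cc defs\<close>)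
  moreover have "p * \<dots> \<le> card ((centralizer u \<inter> centralizer v) \<inter> centralizer c)"
    by (rule card_centralizer_Int[of _ z c]) (use c2 t in \<open>auto intro!: subs simp: cc defs\<close>)
  moreover have "p * \<dots> \<le> card (centralizer u \<inter> centralizer v)"
    by (rule card_centralizer_Int[of _ c z], intro subs) (use c1 t swap_ne[of c z] in \<open>auto simp: defs\<close>)
  moreover have "p * \<dots> \<le> card (centralizer u)"
    by (rule card_centralizer_Int[of _ v y], intro subs) (use c1 inv_ne vy swap_ne[of v y] in \<open>auto simp: defs\<close>)
  moreover have "p * \<dots> \<le> card (carrier G)"
    using card_centralizer_Int[of "carrier G" u x] t ux swap_ne[of u x] subgroup.subset[OF centralizer_subgroup[of u]]
    by (simp add: subgroup_self Int_absorb1)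
  ultimately have K6_le: "729 * card K6 \<le> card (carrier G)"
    unfolding p3 by linarith
  have K6: "subgroup K6 G" unfolding K6_def by (intro subs) simp_all
  \<comment> \<open>The triple commutators have order dividing 3, and 3 divides \<open>q\<close>, so
    \<open>q\<close>-th powers of \<open>c\<close> and \<open>v\<close> commute with
    \<open>x\<close>, \<open>y\<close>, \<open>z\<close>.\<close>
  have pow_K6: "comm a b [^] q \<in> K6" if ab: "comm a b \<in> {c, v}" "a \<in> carrier G" "b \<in> carrier G" for a b
  proof -
    have "comm a b [^] q \<in> centralizer g" if g: "g \<in> {x, y, z}" for g
    proof -
      have [simp]: "g \<in> carrier G" using g by auto
      have T: "comm (comm a b) g \<in> {t, inv t, \<one>}"
        using ab g vy by (auto simp: defs comm_comm_self)
      have "comm (comm a b [^] q) g = comm (comm a b) g [^] q"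
        using ab g by (intro comm_int_pow_left central) auto
      also have "\<dots> = \<one>" using T tq by (auto simp: int_pow_inv)
      finally show ?thesis using ab by (simp add: centralizer_iff)
    qed
    moreover have "comm a b [^] q \<in> centralizer w" if w: "w \<in> {c, u, v}" for w
      using w ab unfolding defs
      by (auto intro!: subgroup_int_pow_closed[OF centralizer_subgroup] cc)
    ultimately show ?thesis by (simp add: K6_def)
  qed
  have cq: "c [^] q \<in> K6" and vq: "v [^] q \<in> K6"
    using pow_K6[of x y] pow_K6[of x z] by (simp_all add: defs)
  \<comment> \<open>Contrapositive of the centrality of elements killed by \<open>q\<close>. Applied
    to \<open>c\<close>, \<open>v\<close>, \<open>c v\<close> and \<open>c v^-1\<close> it separates
    four elements of \<open>K6\<close>.\<close>
  have ne: "w [^] q \<noteq> \<one>" if w: "w \<in> carrier G" "comm w z \<noteq> \<one> \<or> comm w y \<noteq> \<one>" for w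
  proof
    assume "w [^] q = \<one>"
    then have "w \<in> centre" using e(1) w by (simp add: q_def)
    then show False using w by (auto simp: centre_iff)
  qed
  have vz: "comm v z = \<one>" by (simp add: defs comm_comm_self)
  have cv: "c \<otimes> v = v \<otimes> c"
    using comm_comm_comm[of x y x z] by (simp add: defs comm_eq_one_iff)
  have cq1: "c [^] q \<noteq> \<one>" using t by (intro ne) (auto simp: defs)
  have vq1: "v [^] q \<noteq> \<one>" using vy inv_ne by (intro ne) auto
  have one_c: "\<one> \<in> centre" by (rule subgroup.one_closed[OF centre_subgroup])
  have "comm (c \<otimes> v) z = t"
    using vz one_c by (simp add: comm_mult_left defs)
  then have "(c \<otimes> v) [^] q \<noteq> \<one>" using t by (intro ne) auto
  then have cvq: "c [^] q \<otimes> v [^] q \<noteq> \<one>" by (simp add: int_pow_mult_distrib[OF cv])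
  have "comm (c \<otimes> inv v) z = t"
    using vz one_c by (simp add: comm_mult_left defs comm_inv_left)
  then have "(c \<otimes> inv v) [^] q \<noteq> \<one>" using t by (intro ne) auto
  moreover have "(c \<otimes> inv v) [^] q = c [^] q \<otimes> inv (v [^] q)"
    using inv_commute[of v c] cv by (subst int_pow_mult_distrib) (simp_all add: int_pow_inv)
  ultimately have cvq': "c [^] q \<noteq> v [^] q" by auto
  \<comment> \<open>Four elements are enough: \<open>3^6 * 4 = 2916\<close> exceeds
    \<open>3^7 = 2187\<close>.\<close>
  have "{\<one>, c [^] q, v [^] q, c [^] q \<otimes> v [^] q} \<subseteq> K6"
    using cq vq K6 by (simp add: subgroup.one_closed subgroup.m_closed)
  then have "card {\<one>, c [^] q, v [^] q, c [^] q \<otimes> v [^] q} \<le> card K6"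
    by (intro card_mono finite_subgroup K6)
  moreover have "card {\<one>, c [^] q, v [^] q, c [^] q \<otimes> v [^] q} = 4"
    using cq1 vq1 cvq cvq' by (auto simp: card_insert_if)
  ultimately have "729 * 4 \<le> order G" using K6_le by (simp add: order_def)
  with small show False by (simp add: p3)
qed

end

section \<open>Groups of class 2\<close>

lemma (in group) comm_self [simp]: "z \<in> carrier G \<Longrightarrow> comm z z = \<one>"
  by (simp add: comm_eq_one_iff)

locale class2_group = group +
  assumes comm_centre: "x \<in> carrier G \<Longrightarrow> y \<in> carrier G \<Longrightarrow> comm x y \<in> centre"
begin

lemma comm_int_pow_l:
  "x \<in> carrier G \<Longrightarrow> y \<in> carrier G \<Longrightarrow> comm (x [^] (n::int)) y = comm x y [^] n"
  by (simp add: comm_int_pow_left comm_centre)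

lemma comm_int_pow_r:
  assumes "x \<in> carrier G" "y \<in> carrier G"
  shows "comm x (y [^] (n::int)) = comm x y [^] n"
proof -
  have "comm x (y [^] n) = inv (comm (y [^] n) x)" using assms by (simp add: inv_comm)
  also have "\<dots> = inv (comm y x) [^] n" using assms by (simp add: comm_int_pow_l int_pow_inv)
  finally show ?thesis using assms by (simp add: inv_comm)
qed

lemma comm_mult_l:
  "x \<in> carrier G \<Longrightarrow> y \<in> carrier G \<Longrightarrow> z \<in> carrier G \<Longrightarrow> comm (x \<otimes> y) z = comm x z \<otimes> comm y z"
  by (simp add: comm_mult_left comm_centre)

lemma comm_mult_r:
  "x \<in> carrier G \<Longrightarrow> y \<in> carrier G \<Longrightarrow> z \<in> carrier G \<Longrightarrow> comm x (y \<otimes> z) = comm x y \<otimes> comm x z"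
  by (simp add: comm_mult_right comm_centre)

lemma swap:
  assumes "x \<in> carrier G" "y \<in> carrier G"
  shows "x \<otimes> y = comm x y \<otimes> (y \<otimes> x)"
  using assms by (simp add: comm_def group_word)

lemma derived_centre: "derived G (carrier G) \<subseteq> centre"
  by (rule derived_subset[OF centre_subgroup comm_centre])

lemma centre_int_pow: "z \<in> centre \<Longrightarrow> z [^] (n::int) \<in> centre"
  by (rule subgroup_int_pow_closed[OF centre_subgroup])

lemma centre_mult: "y \<in> centre \<Longrightarrow> z \<in> centre \<Longrightarrow> y \<otimes> z \<in> centre"
  by (rule subgroup.m_closed[OF centre_subgroup])

lemma pow_mult:
  assumes [simp]: "x \<in> carrier G" "y \<in> carrier G"
  shows "(x \<otimes> y) [^] (n::nat) = comm y x [^] (n choose 2) \<otimes> (x [^] n \<otimes> y [^] n)"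
proof (induction n)
  case (Suc n)
  define c where "c = comm y x"
  have c: "c \<in> centre" and [simp]: "c \<in> carrier G" by (simp_all add: c_def comm_centre)
  have cp: "c [^] k \<in> centre" for k :: nat
    using centre_int_pow[OF c, of "int k"] by (simp add: int_pow_int)
  have "comm (y [^] n) x = c [^] n"
    using comm_int_pow_l[of y x "int n"] by (simp add: int_pow_int c_def)
  then have yx: "y [^] n \<otimes> x = c [^] n \<otimes> (x \<otimes> y [^] n)"
    using swap[of "y [^] n" x] by simp
  have "(x \<otimes> y) [^] Suc n = c [^] (n choose 2) \<otimes> (x [^] n \<otimes> (y [^] n \<otimes> x \<otimes> y))"
    by (simp add: Suc c_def[symmetric] m_assoc)
  also have "\<dots> = c [^] (n choose 2) \<otimes> (c [^] n \<otimes> (x [^] Suc n \<otimes> y [^] Suc n))"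
    unfolding yx by (simp add: m_assoc centre_left_commute[OF cp[of n], of "x [^] n"])
  also have "\<dots> = c [^] (Suc n choose 2) \<otimes> (x [^] Suc n \<otimes> y [^] Suc n)"
    by (simp add: nat_pow_mult numeral_2_eq_2 add.commute flip: m_assoc)
  finally show ?case by (simp add: c_def)
qed (simp add: numeral_2_eq_2)

text \<open>For odd \<open>n\<close> the binomial coefficient \<open>n choose 2\<close> is a
  multiple of \<open>n\<close>, so the commutator factor in \<open>pow_mult\<close>
  vanishes.\<close>

lemma pow_hom:
  assumes "odd n" "\<And>x y. x \<in> carrier G \<Longrightarrow> y \<in> carrier G \<Longrightarrow> comm x y [^] int n = \<one>"
  shows "(\<lambda>x. x [^] int n) \<in> hom G G"
proof (rule homI)
  fix x y assume [simp]: "x \<in> carrier G" "y \<in> carrier G"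
  obtain k where "n = 2 * k + 1" using \<open>odd n\<close> by (rule oddE)
  then have k: "n choose 2 = n * k" by (simp add: choose_two)
  have "comm y x [^] (n choose 2) = (comm y x [^] n) [^] k"
    by (simp add: k nat_pow_pow)
  then have "comm y x [^] (n choose 2) = \<one>"
    using assms(2)[of y x] by (simp add: int_pow_int)
  then show "(x \<otimes> y) [^] int n = x [^] int n \<otimes> y [^] int n"
    by (simp add: int_pow_int pow_mult)
qed simp

definition gens :: "'a \<Rightarrow> 'a \<Rightarrow> 'a \<Rightarrow> int \<Rightarrow> int \<Rightarrow> int \<Rightarrow> 'a" where
  "gens x y w i j l = x [^] i \<otimes> (y [^] j \<otimes> w [^] l)"

text \<open>The cyclic order \<open>[y,w]\<close>, \<open>[w,x]\<close>, \<open>[x,y]\<close> makes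
  the exponents of a commutator of two \<open>gens\<close> the cross product of their exponent
  vectors (\<open>comm_gens_gens\<close>). This matches the cyclic cofactor formula of
  \<open>cof\<close>, without extra signs.\<close>

definition comms :: "'a \<Rightarrow> 'a \<Rightarrow> 'a \<Rightarrow> int \<Rightarrow> int \<Rightarrow> int \<Rightarrow> 'a" where
  "comms x y w a b d = gens (comm y w) (comm w x) (comm x y) a b d"

context
  fixes x y w
  assumes [simp]: "x \<in> carrier G" "y \<in> carrier G" "w \<in> carrier G"
begin

lemma gens_closed [simp]: "gens x y w i j l \<in> carrier G"
  by (simp add: gens_def)

lemma comms_closed [simp]: "comms x y w i j l \<in> carrier G"
  by (simp add: comms_def gens_def)

lemma comms_centre: "comms x y w a b d \<in> centre"
  by (simp add: comms_def gens_def centre_mult centre_int_pow comm_centre)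

lemma comms_mult: "comms x y w a b d \<otimes> comms x y w a' b' d' = comms x y w (a + a') (b + b') (d + d')"
proof -
  have c: "comm y w [^] a' \<in> centre" "comm w x [^] b' \<in> centre"
    by (simp_all add: centre_int_pow comm_centre)
  show ?thesis
    by (simp add: comms_def gens_def int_pow_mult m_assoc
        centre_left_commute[OF c(1), of "comm w x [^] b"] centre_left_commute[OF c(1), of "comm x y [^] d"]
        centre_left_commute[OF c(2), of "comm x y [^] d"])
qed

lemma comms_zero [simp]: "comms x y w 0 0 0 = \<one>"
  by (simp add: comms_def gens_def)

lemma inv_comms: "inv (comms x y w a b d) = comms x y w (- a) (- b) (- d)"
  by (rule inv_equality) (simp_all add: comms_mult)

lemma comms_int_pow: "comms x y w a b d [^] (n::int) = comms x y w (a * n) (b * n) (d * n)"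
proof -
  have "comms x y w a b d [^] m = comms x y w (a * int m) (b * int m) (d * int m)" for m :: nat
    by (induction m) (simp_all add: comms_mult algebra_simps)
  then show ?thesis
    by (cases n rule: int_cases2) (simp_all add: int_pow_int int_pow_neg inv_comms)
qed

lemma comm_gens_l: "z \<in> carrier G \<Longrightarrow> comm (gens x y w i j l) z = gens (comm x z) (comm y z) (comm w z) i j l"
  by (simp add: gens_def comm_mult_l comm_int_pow_l)

lemma comm_gens_r: "z \<in> carrier G \<Longrightarrow> comm z (gens x y w i j l) = gens (comm z x) (comm z y) (comm z w) i j l"
  by (simp add: gens_def comm_mult_r comm_int_pow_r)

lemma comm_gens_gens:
  "comm (gens x y w i j l) (gens x y w i' j' l') = comms x y w (j * l' - l * j') (l * i' - i * l') (i * j' - j * i')"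
proof -
  have neg: "comm b a [^] n = comm a b [^] (- n)" if "a \<in> carrier G" "b \<in> carrier G" for a b and n :: int
    using that by (simp add: inv_comm[symmetric, of a b] int_pow_inv int_pow_neg)
  have com: "comm a b [^] (m::int) \<otimes> comm c d [^] (n::int) = comm c d [^] n \<otimes> comm a b [^] m"
    if "a \<in> carrier G" "b \<in> carrier G" "c \<in> carrier G" "d \<in> carrier G" for a b c d m n
    using that by (simp add: centre_commute[of "comm c d [^] n"] centre_int_pow comm_centre)
  have "comm x (gens x y w i' j' l') = comms x y w 0 (- l') j'"
    by (subst comm_gens_r) (simp_all add: gens_def comms_def neg[of w x l'] com)
  moreover have "comm y (gens x y w i' j' l') = comms x y w l' 0 (- i')"
    by (subst comm_gens_r) (simp_all add: gens_def comms_def neg[of x y i'] com[of x y y w])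
  moreover have "comm w (gens x y w i' j' l') = comms x y w (- j') i' 0"
    by (subst comm_gens_r) (simp_all add: gens_def comms_def neg[of y w j'] com[of w x y w])
  ultimately have "comm (gens x y w i j l) (gens x y w i' j' l') = gens (comms x y w 0 (- l') j') (comms x y w l' 0 (- i')) (comms x y w (- j') i' 0) i j l"
    by (subst comm_gens_l) simp_all
  then show ?thesis
    by (simp add: gens_def comms_int_pow comms_mult algebra_simps)
qed

text \<open>Collection: \<open>x^i'\<close> moves left past \<open>y^j\<close> and
  \<open>w^l\<close>, then \<open>y^j'\<close> past \<open>w^l\<close>. Each exchange leaves a
  central commutator, and the signs come from \<open>[w,y]\<close> and \<open>[y,x]\<close> being
  inverses of basic commutators.\<close>

lemma gens_mult:
  "gens x y w i j l \<otimes> gens x y w i' j' l' =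
   gens x y w (i + i') (j + j') (l + l') \<otimes> comms x y w (- (l * j')) (l * i') (- (j * i'))"
proof -
  define A B U A' B' U' where defs: "A = x [^] i" "B = y [^] j" "U = w [^] l" "A' = x [^] i'" "B' = y [^] j'" "U' = w [^] l'"
  have [simp]: "A \<in> carrier G" "B \<in> carrier G" "U \<in> carrier G" "A' \<in> carrier G" "B' \<in> carrier G" "U' \<in> carrier G"
    by (simp_all add: defs)
  define C where "C = comms x y w (- (l * j')) (l * i') (- (j * i'))"
  have C: "comm (B \<otimes> U) A' \<otimes> comm U B' = C"
  proof -
    have 1: "comm (B \<otimes> U) A' = comm (gens x y w 0 j l) (gens x y w i' 0 0)"
      by (simp add: gens_def defs)
    have 2: "comm U B' = comm (gens x y w 0 0 l) (gens x y w 0 j' 0)"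
      by (simp add: gens_def defs)
    show ?thesis unfolding 1 2 comm_gens_gens C_def by (simp add: comms_mult)
  qed
  have c1: "comm (B \<otimes> U) A' \<in> centre" and c2: "comm U B' \<in> centre" by (simp_all add: comm_centre)
  have Cc [simp]: "C \<in> carrier G" and Cz: "C \<in> centre" by (simp_all add: C_def comms_centre)
  have "A \<otimes> (B \<otimes> U) \<otimes> (A' \<otimes> (B' \<otimes> U')) = A \<otimes> (((B \<otimes> U) \<otimes> A') \<otimes> (B' \<otimes> U'))"
    by (simp add: m_assoc)
  also have "\<dots> = comm (B \<otimes> U) A' \<otimes> ((A \<otimes> A') \<otimes> (B \<otimes> ((U \<otimes> B') \<otimes> U')))"
    using swap[of "B \<otimes> U" A'] by (simp add: m_assoc centre_left_commute[OF c1, of A])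
  also have "\<dots> = comm (B \<otimes> U) A' \<otimes> (comm U B' \<otimes> ((A \<otimes> A') \<otimes> ((B \<otimes> B') \<otimes> (U \<otimes> U'))))"
    using swap[of U B']
    by (simp add: m_assoc centre_left_commute[OF c2, of B] centre_left_commute[OF c2, of A'] centre_left_commute[OF c2, of A])
  also have "\<dots> = C \<otimes> ((A \<otimes> A') \<otimes> ((B \<otimes> B') \<otimes> (U \<otimes> U')))"
    unfolding C[symmetric] by (simp add: m_assoc)
  also have "\<dots> = ((A \<otimes> A') \<otimes> ((B \<otimes> B') \<otimes> (U \<otimes> U'))) \<otimes> C"
    by (rule centre_commute[OF Cz, symmetric]) simp
  finally show ?thesis by (simp add: gens_def defs int_pow_mult C_def)
qed

end

end

lemma (in group) order_eq_image_kernel: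
  assumes H: "group H" and f: "f \<in> hom G H"
  shows "order G = card (f ` carrier G) * card (kernel G H f)"
proof -
  interpret f: group_hom G H f using H f is_group by (simp add: group_hom_def group_hom_axioms_def)
  have sub: "subgroup (f ` carrier G) H" by (rule f.img_is_subgroup)
  interpret I: group_hom G "H\<lparr>carrier := f ` carrier G\<rparr>" f
    using f.H.subgroup_imp_group[OF sub] f is_group
    by (auto simp: group_hom_def group_hom_axioms_def hom_def)
  have ker: "kernel G (H\<lparr>carrier := f ` carrier G\<rparr>) f = kernel G H f"
    by (simp add: kernel_def)
  have "card (carrier (G Mod kernel G H f)) = card (f ` carrier G)"
    using iso_same_card[OF I.FactGroup_iso] by (simp add: ker)
  then have "card (rcosets (kernel G H f)) = card (f ` carrier G)"
    by (simp add: FactGroup_def)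
  then show ?thesis using lagrange[OF f.subgroup_kernel] by simp
qed

section \<open>Orders of centre and derived subgroup in a hypothetical non-abelian
  counterexample\<close>

locale small_pE_group = finite_pE_group +
  assumes odd_p: "odd p" and small: "order G \<le> p ^ 7"
    and nonabelian: "\<exists>x\<in>carrier G. \<exists>y\<in>carrier G. comm x y \<noteq> \<one>"

sublocale small_pE_group \<subseteq> class2_group
  by unfold_locales (rule comm_in_centre[OF small])

context small_pE_group begin

text \<open>\<open>[x,y]^(p^e) = [x^(p^e), y] = 1\<close>, because \<open>x^(p^e)\<close> lies in
  the derived subgroup, which is central in class 2. So \<open>pow_hom\<close> applies. The case
  \<open>e = 0\<close> would make the group perfect and central at once.\<close>

lemma power_map:
  obtains e where "e > 0" "(\<lambda>x. x [^] int (p ^ e)) \<in> hom G G"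
    "\<And>x. x \<in> carrier G \<Longrightarrow> x [^] int (p ^ e) \<in> derived G (carrier G)"
    "\<And>x. x \<in> carrier G \<Longrightarrow> x [^] int (p ^ e) = \<one> \<Longrightarrow> x \<in> centre"
proof -
  obtain e where e: "\<And>x. x \<in> carrier G \<Longrightarrow> x [^] int (p ^ e) \<in> derived G (carrier G)"
    "\<And>x. x \<in> carrier G \<Longrightarrow> x [^] int (p ^ e) = \<one> \<Longrightarrow> x \<in> centre"
    "e = 0 \<Longrightarrow> derived G (carrier G) = carrier G"
    by (rule derived_exponent) blast
  have "e \<noteq> 0"
  proof
    assume "e = 0"
    then have "carrier G \<subseteq> centre" using e(3) derived_centre by simp
    then show False using nonabelian unfolding centre_iff by (auto simp: subset_iff centre_iff)
  qed
  moreover have "(\<lambda>x. x [^] int (p ^ e)) \<in> hom G G"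
  proof (rule pow_hom)
    fix x y assume xy: "x \<in> carrier G" "y \<in> carrier G"
    then have "x [^] int (p ^ e) \<in> centre" using e(1) derived_centre by auto
    then show "comm x y [^] int (p ^ e) = \<one>"
      using comm_int_pow_l[OF xy, of "int (p ^ e)"] xy by (simp add: centre_iff)
  qed (simp add: odd_p)
  ultimately show ?thesis using that[of e] e(1,2) by simp
qed

lemma order_le_centre_image:
  assumes "f \<in> hom G G" "f ` carrier G \<subseteq> S" "finite S" "\<And>x. x \<in> carrier G \<Longrightarrow> f x = \<one> \<Longrightarrow> x \<in> centre"
  shows "order G \<le> card S * card centre"
proof -
  have "order G = card (f ` carrier G) * card (kernel G G f)"
    by (rule order_eq_image_kernel[OF is_group assms(1)])
  also have "\<dots> \<le> card S * card centre"
    using assms by (intro mult_le_mono card_mono finite_subgroup[OF centre_subgroup]) (auto simp: kernel_def)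
  finally show ?thesis .
qed

text \<open>Image and kernel of the power map both lie in the centre. With
  \<open>order G = p^n\<close> and \<open>card centre = p^k\<close> this gives
  \<open>n <= 2k\<close>; adding \<open>n <= 7\<close> gives \<open>2n <= 2k + 7\<close>, hence
  \<open>n <= k + 3\<close>.\<close>

lemma order_le: "order G \<le> p ^ 3 * card centre"
proof -
  obtain e where e: "(\<lambda>x. x [^] int (p ^ e)) \<in> hom G G"
    "\<And>x. x \<in> carrier G \<Longrightarrow> x [^] int (p ^ e) \<in> derived G (carrier G)"
    "\<And>x. x \<in> carrier G \<Longrightarrow> x [^] int (p ^ e) = \<one> \<Longrightarrow> x \<in> centre"
    by (rule power_map) blast
  have le: "order G \<le> card centre * card centre"
    by (rule order_le_centre_image[OF e(1)])
      (use e(2,3) derived_centre finite_subgroup[OF centre_subgroup] in auto)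
  obtain n k where nk: "order G = p ^ n" "card centre = p ^ k"
    using order_prime_power card_subgroup[OF centre_subgroup] by blast
  have "n \<le> k + k" using le p_gt_1 by (simp add: nk power_add[symmetric])
  moreover have "n \<le> 7" using small p_gt_1 by (simp add: nk)
  ultimately have "n \<le> 3 + k" by linarith
  then have "p ^ n \<le> p ^ (3 + k)" using p_gt_1 by (intro power_increasing) auto
  then show ?thesis by (simp add: nk power_add)
qed

lemma centre_adjoin: "derived G (carrier G) \<subseteq> H \<Longrightarrow> H \<subseteq> carrier G \<Longrightarrow> derived G (carrier G) \<subseteq> adjoin H g"
  using subset_adjoin by blast

text \<open>If \<open>[u, v]\<^sup>p \<noteq> 1\<close>, then adjoining \<open>u\<^sup>p\<close>, \<open>u\<close>, \<open>v\<^sup>p\<close>, \<open>v\<close> to the centre gives four proper steps.\<close>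
lemma comm_pow_p:
  assumes [simp]: "u \<in> carrier G" "v \<in> carrier G"
  shows "comm u v [^] int p = \<one>"
proof (rule ccontr)
  assume ne: "comm u v [^] int p \<noteq> \<one>"
  define c where "c = comm u v"
  have [simp]: "c \<in> carrier G" by (simp add: c_def)
  have c_pow: "int p dvd n" if "c [^] n = \<one>" for n
  proof (rule ccontr)
    assume "\<not> int p dvd n"
    then have "c = \<one>" using eq_one_if_coprime_pow[of c n] that by simp
    with ne show False by (simp add: c_def)
  qed
  have c_pow': "c [^] (1 - int p * i) \<noteq> \<one>" for i
  proof
    assume "c [^] (1 - int p * i) = \<one>"
    from dvd_add[OF c_pow[OF this] dvd_triv_left[of "int p" i]] show False using p_gt_1 by simp
  qed
  define A1 where "A1 = adjoin centre (u [^] int p)"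
  define A2 where "A2 = adjoin A1 u"
  define A3 where "A3 = adjoin A2 (v [^] int p)"
  define A4 where "A4 = adjoin A3 v"
  note D = derived_centre
  have A1: "subgroup A1 G" "derived G (carrier G) \<subseteq> A1"
    unfolding A1_def using adjoin_subgroup[OF centre_subgroup D] centre_adjoin[OF D subgroup.subset[OF centre_subgroup]] by simp_all
  have A2: "subgroup A2 G" "derived G (carrier G) \<subseteq> A2"
    unfolding A2_def using adjoin_subgroup[OF A1] centre_adjoin[OF A1(2) subgroup.subset[OF A1(1)]] by simp_all
  have A3: "subgroup A3 G" "derived G (carrier G) \<subseteq> A3"
    unfolding A3_def using adjoin_subgroup[OF A2] centre_adjoin[OF A2(2) subgroup.subset[OF A2(1)]] by simp_all
  have A4: "subgroup A4 G" unfolding A4_def using adjoin_subgroup[OF A3] by simp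
  \<comment> \<open>Commutators with \<open>u\<close> and \<open>v\<close> separate the chain. On
    \<open>A1\<close> the commutator with \<open>v\<close> is a power of \<open>c^p\<close>, but
    \<open>[u,v] = c\<close> is not; on \<open>A2\<close> everything commutes with \<open>u\<close>,
    but \<open>v^p\<close> does not; on \<open>A3\<close> the commutator with \<open>u\<close> is a
    power of \<open>c^p\<close>, but \<open>[u,v]\<close> is not.\<close>
  have A1_form: "\<exists>i. comm g v = c [^] (int p * i) \<and> comm u g = \<one>" if "g \<in> A1" for g
  proof -
    obtain z i where g: "z \<in> centre" "g = z \<otimes> (u [^] int p) [^] (i::int)"
      using \<open>g \<in> A1\<close> unfolding A1_def by (rule adjoinE)
    have [simp]: "z \<in> carrier G" using g(1) by (rule centre_carrier)
    have "comm z v = \<one>" "comm u z = \<one>"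
      using g(1) comm_swap_eq_one[of z u] by (simp_all add: centre_iff)
    then show ?thesis
      by (intro exI[of _ i]) (simp add: g int_pow_pow comm_mult_l comm_mult_r comm_int_pow_l comm_int_pow_r c_def)
  qed
  have A2_form: "comm u g = \<one>" if "g \<in> A2" for g
  proof -
    obtain z i where g: "z \<in> A1" "g = z \<otimes> u [^] (i::int)"
      using \<open>g \<in> A2\<close> unfolding A2_def by (rule adjoinE)
    have [simp]: "z \<in> carrier G" using g(1) by (rule subgroup.mem_carrier[OF A1(1)])
    show ?thesis using A1_form[OF g(1)] by (auto simp: g comm_mult_r comm_int_pow_r)
  qed
  have A3_form: "\<exists>i. comm u g = c [^] (int p * i)" if "g \<in> A3" for g
  proof -
    obtain z i where g: "z \<in> A2" "g = z \<otimes> (v [^] int p) [^] (i::int)"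
      using \<open>g \<in> A3\<close> unfolding A3_def by (rule adjoinE)
    have [simp]: "z \<in> carrier G" using g(1) by (rule subgroup.mem_carrier[OF A2(1)])
    show ?thesis using A2_form[OF g(1)]
      by (intro exI[of _ i]) (simp add: g int_pow_pow comm_mult_r comm_int_pow_r c_def)
  qed
  have "u [^] int p \<notin> centre"
    using ne by (auto simp: centre_iff comm_int_pow_l)
  then have "p * card centre \<le> card A1"
    unfolding A1_def by (intro card_adjoin centre_subgroup D) simp_all
  moreover have "u \<notin> A1"
  proof
    assume "u \<in> A1"
    then obtain i where "c = c [^] (int p * i)" using A1_form by (auto simp: c_def)
    then have "c [^] (1 - int p * i) = \<one>" by (simp add: int_pow_diff)
    then show False using c_pow' by blast
  qed
  then have "p * card A1 \<le> card A2"
    unfolding A2_def by (intro card_adjoin A1) simp_all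
  moreover have "v [^] int p \<notin> A2"
    using A2_form[of "v [^] int p"] ne comm_int_pow_r[of u v "int p"] by auto
  then have "p * card A2 \<le> card A3"
    unfolding A3_def by (intro card_adjoin A2) simp_all
  moreover have "v \<notin> A3"
  proof
    assume "v \<in> A3"
    then obtain i where "c = c [^] (int p * i)" using A3_form by (auto simp: c_def)
    then have "c [^] (1 - int p * i) = \<one>" by (simp add: int_pow_diff)
    then show False using c_pow' by blast
  qed
  then have "p * card A3 \<le> card A4"
    unfolding A4_def by (intro card_adjoin A3) simp_all
  ultimately have "p * (p * (p * (p * card centre))) \<le> card A4"
    by (meson le_trans mult_le_mono2)
  also have "card A4 \<le> p ^ 3 * card centre"
    using card_mono[OF fin subgroup.subset[OF A4]] order_le by (simp add: order_def)
  finally have "p * card centre \<le> 1 * card centre"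
    using p_gt_1 by (simp add: power3_eq_cube mult.assoc)
  moreover have "card centre > 0"
    using subgroup.one_closed[OF centre_subgroup] finite_subgroup[OF centre_subgroup] by (auto simp: card_gt_0_iff)
  ultimately show False using p_gt_1 by simp
qed

end

section \<open>Three generators modulo the centre and a normal form\<close>

context class2_group begin

definition comm_span :: "'a \<Rightarrow> 'a \<Rightarrow> 'a \<Rightarrow> 'a set" where
  "comm_span x y w = (\<lambda>(a, b, d). comms x y w a b d) ` UNIV"

lemma comms_mem_span [simp]: "comms x y w a b d \<in> comm_span x y w"
  unfolding comm_span_def by (rule image_eqI[of _ _ "(a, b, d)"]) auto

lemma comm_spanE:
  assumes "c \<in> comm_span x y w"
  obtains a b d where "c = comms x y w a b d"
  using assms unfolding comm_span_def by auto

lemma comm_span_subgroup: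
  assumes [simp]: "x \<in> carrier G" "y \<in> carrier G" "w \<in> carrier G"
  shows "subgroup (comm_span x y w) G"
proof (rule subgroupI)
  show "comm_span x y w \<subseteq> carrier G" by (auto elim: comm_spanE)
  show "comm_span x y w \<noteq> {}" using comms_mem_span by blast
qed (auto elim!: comm_spanE simp: inv_comms comms_mult)

lemma derived_subset_comm_span:
  assumes [simp]: "x \<in> carrier G" "y \<in> carrier G" "w \<in> carrier G"
    and gen: "\<And>g. g \<in> carrier G \<Longrightarrow> \<exists>i j l. \<exists>z\<in>centre. g = gens x y w i j l \<otimes> z"
  shows "derived G (carrier G) \<subseteq> comm_span x y w"
proof (rule derived_subset[OF comm_span_subgroup])
  fix g h assume "g \<in> carrier G" "h \<in> carrier G"
  then obtain i j l z i' j' l' z' where z: "z \<in> centre" "z' \<in> centre"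
    and gh: "g = gens x y w i j l \<otimes> z" "h = gens x y w i' j' l' \<otimes> z'"
    using gen by meson
  have [simp]: "z \<in> carrier G" "z' \<in> carrier G" using z by (simp_all add: centre_carrier)
  have "comm z k = \<one>" "comm k z' = \<one>" if "k \<in> carrier G" for k
    using z that comm_swap_eq_one[of z' k] by (simp_all add: centre_iff)
  then have "comm g h = comm (gens x y w i j l) (gens x y w i' j' l')"
    by (simp add: gh comm_mult_l comm_mult_r)
  then show "comm g h \<in> comm_span x y w" by (simp add: comm_gens_gens)
qed simp_all

end

lemma (in group) int_pow_mod:
  assumes "x \<in> carrier G" "x [^] (m::int) = \<one>"
  shows "x [^] (n mod m) = x [^] n"
proof -
  have "x [^] n = x [^] (m * (n div m) + n mod m)" by simp
  also have "\<dots> = (x [^] m) [^] (n div m) \<otimes> x [^] (n mod m)"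
    unfolding int_pow_mult[OF assms(1)] int_pow_pow[OF assms(1)] ..
  finally show ?thesis using assms by simp
qed

context small_pE_group begin

lemma pow_p_centre: "g \<in> carrier G \<Longrightarrow> g [^] int p \<in> centre"
  by (simp add: centre_iff comm_int_pow_l comm_pow_p)

lemma comms_mod:
  assumes [simp]: "x \<in> carrier G" "y \<in> carrier G" "w \<in> carrier G"
  shows "comms x y w (a mod int p) (b mod int p) (d mod int p) = comms x y w a b d"
  by (simp add: comms_def gens_def int_pow_mod comm_pow_p)

lemma comms_pow_p:
  assumes [simp]: "x \<in> carrier G" "y \<in> carrier G" "w \<in> carrier G"
  shows "comms x y w a b d [^] int p = \<one>"
  using comms_mod[OF assms, of "a * int p" "b * int p" "d * int p"] by (simp add: comms_int_pow)

lemma comm_span_eq: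
  assumes "x \<in> carrier G" "y \<in> carrier G" "w \<in> carrier G"
  shows "comm_span x y w = (\<lambda>(a, b, d). comms x y w a b d) ` ({0..<int p} \<times> {0..<int p} \<times> {0..<int p})"
proof -
  have "comms x y w a b d \<in> (\<lambda>(a, b, d). comms x y w a b d) ` ({0..<int p} \<times> {0..<int p} \<times> {0..<int p})" for a b d
    using p_gt_1 by (intro image_eqI[of _ _ "(a mod int p, b mod int p, d mod int p)"]) (simp_all add: comms_mod assms)
  then show ?thesis
    unfolding comm_span_def by (intro equalityI image_mono image_subsetI) auto
qed

lemma card_centre_pos: "card centre > 0"
  using subgroup.one_closed[OF centre_subgroup] finite_subgroup[OF centre_subgroup] by (auto simp: card_gt_0_iff)

text \<open>Two noncommuting elements account for a factor \<open>p^2\<close> over the centre. If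
  they and the centre were everything, the derived subgroup would consist of powers of one
  commutator of order \<open>p\<close>, contradicting |G/Z| <= |G'|. A third generator then reaches
  the bound of \<open>order_le\<close>, which becomes an equality.\<close>

lemma three_generators:
  obtains x y w where "x \<in> carrier G" "y \<in> carrier G" "w \<in> carrier G" "order G = p ^ 3 * card centre"
    "\<And>g. g \<in> carrier G \<Longrightarrow> \<exists>i j l. \<exists>z\<in>centre. g = gens x y w i j l \<otimes> z"
proof -
  obtain x y where [simp]: "x \<in> carrier G" "y \<in> carrier G" and xy: "comm x y \<noteq> \<one>"
    using nonabelian by blast
  define A1 where "A1 = adjoin centre x"
  define A2 where "A2 = adjoin A1 y"
  note D = derived_centre
  have A1: "subgroup A1 G" "derived G (carrier G) \<subseteq> A1"
    unfolding A1_def using adjoin_subgroup[OF centre_subgroup D] centre_adjoin[OF D subgroup.subset[OF centre_subgroup]] by simp_all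
  have A2: "subgroup A2 G" "derived G (carrier G) \<subseteq> A2"
    unfolding A2_def using adjoin_subgroup[OF A1] centre_adjoin[OF A1(2) subgroup.subset[OF A1(1)]] by simp_all
  have com_A1: "comm g x = \<one>" if gA: "g \<in> A1" for g
  proof -
    obtain z i where g: "z \<in> centre" "g = z \<otimes> x [^] (i::int)"
      using gA unfolding A1_def by (rule adjoinE)
    then show ?thesis using centre_carrier[OF g(1)] by (simp add: comm_mult_l comm_int_pow_l centre_iff)
  qed
  have "x \<notin> centre" using xy by (auto simp: centre_iff)
  then have "p * card centre \<le> card A1"
    unfolding A1_def by (intro card_adjoin centre_subgroup D) simp_all
  moreover have "y \<notin> A1" using com_A1[of y] comm_swap_eq_one[of y x] xy by auto
  then have "p * card A1 \<le> card A2"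
    unfolding A2_def by (intro card_adjoin A1) simp_all
  ultimately have card_A2: "p * (p * card centre) \<le> card A2"
    by (meson le_trans mult_le_mono2)
  have A2_form: "\<exists>i j. \<exists>z\<in>centre. g = x [^] (i::int) \<otimes> y [^] (j::int) \<otimes> z" if gA: "g \<in> A2" for g
  proof -
    obtain h j where g: "h \<in> A1" "g = h \<otimes> y [^] (j::int)" using gA unfolding A2_def by (rule adjoinE)
    obtain z i where h: "z \<in> centre" "h = z \<otimes> x [^] (i::int)" using g(1) unfolding A1_def by (rule adjoinE)
    have "g = x [^] i \<otimes> y [^] j \<otimes> z"
      using centre_commute[OF h(1), of "x [^] i \<otimes> y [^] j"] centre_carrier[OF h(1)] by (simp add: g(2) h(2) m_assoc)
    with h(1) show ?thesis by blast
  qed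
  have "A2 \<noteq> carrier G"
  proof
    assume eq: "A2 = carrier G"
    \<comment> \<open>The identity as third generator makes the rank 2 case an instance of the rank
      3 lemmas.\<close>
    have "\<exists>i j l. \<exists>z\<in>centre. g = gens x y \<one> i j l \<otimes> z" if gG: "g \<in> carrier G" for g
      using A2_form[of g] gG unfolding eq by (auto simp: gens_def)
    then have D_sub: "derived G (carrier G) \<subseteq> comm_span x y \<one>"
      by (intro derived_subset_comm_span) simp_all
    let ?T = "(\<lambda>d. comm x y [^] d) ` {0..<int p}"
    have "comm_span x y \<one> \<subseteq> ?T"
    proof
      fix c assume "c \<in> comm_span x y \<one>"
      then obtain a b d where "c = comms x y \<one> a b d" by (rule comm_spanE)
      moreover have "comm y \<one> = \<one>" "comm \<one> x = \<one>" by (simp_all add: comm_eq_one_iff)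
      ultimately have "c = comm x y [^] (d mod int p)"
        by (simp add: comms_def gens_def int_pow_mod comm_pow_p)
      then show "c \<in> ?T" using p_gt_1 by auto
    qed
    with D_sub have D_T: "derived G (carrier G) \<subseteq> ?T" by (rule subset_trans)
    obtain e where e: "(\<lambda>x. x [^] int (p ^ e)) \<in> hom G G"
      "\<And>x. x \<in> carrier G \<Longrightarrow> x [^] int (p ^ e) \<in> derived G (carrier G)"
      "\<And>x. x \<in> carrier G \<Longrightarrow> x [^] int (p ^ e) = \<one> \<Longrightarrow> x \<in> centre"
      by (rule power_map) blast
    have "p * (p * card centre) \<le> order G"
      using card_A2 by (simp add: eq order_def)
    also have "\<dots> \<le> card ?T * card centre"
      by (rule order_le_centre_image[OF e(1)]) (use e(2,3) D_T in blast)+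
    also have "\<dots> \<le> p * card centre"
      using card_image_le[of "{0..<int p}" "\<lambda>d. comm x y [^] d"] by (intro mult_le_mono1) simp
    finally have "p * (p * card centre) \<le> p * card centre" .
    then show False using p_gt_1 card_centre_pos by simp
  qed
  then obtain w where [simp]: "w \<in> carrier G" and w: "w \<notin> A2"
    using subgroup.subset[OF A2(1)] by blast
  have "p * card A2 \<le> card (adjoin A2 w)" by (rule card_adjoin[OF A2 _ w]) simp
  then have card_A3: "p ^ 3 * card centre \<le> card (adjoin A2 w)"
    using le_trans[OF mult_le_mono2[OF card_A2, of p]] by (simp only: power3_eq_cube mult.assoc)
  have sub: "adjoin A2 w \<subseteq> carrier G" by (rule subgroup.subset[OF adjoin_subgroup[OF A2]]) simp
  have eq: "adjoin A2 w = carrier G"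
    using order_le card_A3 card_mono[OF fin sub] by (intro card_subset_eq fin sub) (simp add: order_def)
  show ?thesis
  proof (rule that[of x y w])
    show "order G = p ^ 3 * card centre"
      using order_le card_A3 by (simp add: eq order_def)
    fix g assume "g \<in> carrier G"
    then obtain h l where g: "h \<in> A2" "g = h \<otimes> w [^] (l::int)" unfolding eq[symmetric] by (rule adjoinE)
    obtain i j z where h: "z \<in> centre" "h = x [^] (i::int) \<otimes> y [^] (j::int) \<otimes> z" using A2_form[OF g(1)] by blast
    have "g = gens x y w i j l \<otimes> z"
      using centre_commute[OF h(1), of "w [^] l"] centre_carrier[OF h(1)] by (simp add: g(2) h(2) m_assoc gens_def)
    with h(1) show "\<exists>i j l. \<exists>z\<in>centre. g = gens x y w i j l \<otimes> z" by blast
  qed simp_all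
qed

text \<open>Since |G/Z| = p^3 and the commutators span at most \<open>p^3\<close> elements, the
  power map must be onto \<open>comm_span x y w\<close>, with kernel exactly the centre. This makes
  the basic commutators independent, and the bound \<open>p^7\<close> leaves room for at most one
  more central generator \<open>s\<close>.\<close>

lemma normal_form:
  obtains x y w s where
    "x \<in> carrier G" "y \<in> carrier G" "w \<in> carrier G" "s \<in> centre"
    "\<And>g. g \<in> carrier G \<Longrightarrow> \<exists>i j l a b d n. g = gens x y w i j l \<otimes> comms x y w a b d \<otimes> s [^] (n::int)"
    "\<And>a b d. comms x y w a b d = \<one> \<Longrightarrow> int p dvd a \<and> int p dvd b \<and> int p dvd d"
    "\<And>n::int. s [^] n \<in> comm_span x y w \<Longrightarrow> s [^] n = \<one>"
    "(\<lambda>g. g [^] int p) \<in> hom G G" "(\<lambda>g. g [^] int p) ` carrier G = comm_span x y w"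
    "\<And>z. z \<in> centre \<Longrightarrow> z [^] int p = \<one>"
proof -
  obtain x y w where [simp]: "x \<in> carrier G" "y \<in> carrier G" "w \<in> carrier G" and ord: "order G = p ^ 3 * card centre"
    and gen: "\<And>g. g \<in> carrier G \<Longrightarrow> \<exists>i j l. \<exists>z\<in>centre. g = gens x y w i j l \<otimes> z"
    by (rule three_generators) blast
  let ?C = "comm_span x y w" and ?I = "{0..<int p} \<times> {0..<int p} \<times> {0..<int p}"
  have D: "derived G (carrier G) \<subseteq> ?C" by (rule derived_subset_comm_span[OF _ _ _ gen]) simp_all
  have finC: "finite ?C" by (simp add: comm_span_eq)
  have card_I: "card ?I = p ^ 3" by (simp add: card_cartesian_product power3_eq_cube)
  have card_C_le: "card ?C \<le> p ^ 3"
    using card_image_le[of ?I "\<lambda>(a, b, d). comms x y w a b d"] card_I by (simp add: comm_span_eq)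
  obtain e where e0: "e > 0" and e: "(\<lambda>x. x [^] int (p ^ e)) \<in> hom G G"
    "\<And>x. x \<in> carrier G \<Longrightarrow> x [^] int (p ^ e) \<in> derived G (carrier G)"
    "\<And>x. x \<in> carrier G \<Longrightarrow> x [^] int (p ^ e) = \<one> \<Longrightarrow> x \<in> centre"
    by (rule power_map) blast
  let ?P = "\<lambda>x. x [^] int (p ^ e)"
  have P_sub: "?P ` carrier G \<subseteq> ?C" using e(2) D by blast
  have ord_eq: "p ^ 3 * card centre = card (?P ` carrier G) * card (kernel G G ?P)"
    using order_eq_image_kernel[OF is_group e(1)] ord by simp
  have ker_sub: "kernel G G ?P \<subseteq> centre" using e(3) by (auto simp: kernel_def)
  have ker_le: "card (kernel G G ?P) \<le> card centre"
    by (rule card_mono[OF finite_subgroup[OF centre_subgroup] ker_sub])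
  have "p ^ 3 * card centre \<le> card (?P ` carrier G) * card centre"
    unfolding ord_eq by (rule mult_le_mono2[OF ker_le])
  then have im_ge: "p ^ 3 \<le> card (?P ` carrier G)" using card_centre_pos by simp
  have im_eq: "?P ` carrier G = ?C"
    using im_ge card_C_le card_mono[OF finC P_sub] by (intro card_subset_eq finC P_sub) linarith
  have card_C: "card ?C = p ^ 3"
    using im_ge card_C_le card_mono[OF finC P_sub] by linarith
  have "card centre \<le> card (kernel G G ?P)"
    using ord_eq[unfolded im_eq card_C] p_gt_1 by simp
  then have ker_eq: "kernel G G ?P = centre"
    using ker_le by (intro card_subset_eq finite_subgroup[OF centre_subgroup] ker_sub) linarith
  have "card centre * p ^ 3 \<le> p ^ 4 * p ^ 3"
    using small unfolding ord by (simp add: power_add[symmetric] mult.commute)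
  then have card_Z: "card centre \<le> p ^ 4" using p_gt_1 unfolding mult_le_cancel2 by simp
  have C_Z: "?C \<subseteq> centre" by (auto elim!: comm_spanE simp: comms_centre)
  have inj: "inj_on (\<lambda>(a, b, d). comms x y w a b d) ?I"
    by (rule eq_card_imp_inj_on) (simp_all only: card_I card_C[symmetric] comm_span_eq[of x y w] \<open>x \<in> carrier G\<close> \<open>y \<in> carrier G\<close> \<open>w \<in> carrier G\<close>, simp)
  have indep: "int p dvd a \<and> int p dvd b \<and> int p dvd d" if "comms x y w a b d = \<one>" for a b d
  proof -
    have "comms x y w (a mod int p) (b mod int p) (d mod int p) = comms x y w 0 0 0"
      using that by (simp add: comms_mod)
    then have "(a mod int p, b mod int p, d mod int p) = (0, 0, 0)"
      using inj_onD[OF inj, of "(a mod int p, b mod int p, d mod int p)" "(0, 0, 0)"] p_gt_1 by auto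
    then show ?thesis by (simp add: dvd_eq_mod_eq_0)
  qed
  \<comment> \<open>For \<open>e > 1\<close> the map \<open>z \<mapsto> z^(p^(e-1))\<close> on the
    centre has the commutator span, of order \<open>p^3\<close>, inside both its image and its
    kernel. The centre would have order at least \<open>p^6\<close>, against
    \<open>p^4\<close>.\<close>
  have "e = 1"
  proof (rule ccontr)
    assume "e \<noteq> 1"
    with e0 have e1: "e - 1 > 0" by simp
    let ?Z = "G\<lparr>carrier := centre\<rparr>" and ?r = "\<lambda>z. z [^] int (p ^ (e - 1))"
    interpret Z: group ?Z by (rule subgroup_imp_group[OF centre_subgroup])
    have r: "?r \<in> hom ?Z G"
    proof (rule homI)
      fix a b assume ab: "a \<in> carrier ?Z" "b \<in> carrier ?Z"
      then have com: "a \<otimes> b = b \<otimes> a" using centre_commute[of b a] by (simp add: centre_carrier)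
      show "?r (a \<otimes>\<^bsub>?Z\<^esub> b) = ?r a \<otimes> ?r b"
        using ab by (simp add: int_pow_mult_distrib[OF com] centre_carrier)
    qed (simp add: centre_carrier)
    have eq: "card centre = card (?r ` centre) * card (kernel ?Z G ?r)"
      using Z.order_eq_image_kernel[OF is_group r] by (simp add: order_def)
    have pe: "int p * int (p ^ (e - 1)) = int (p ^ e)" "int p dvd int (p ^ (e - 1))"
      using e0 e1 by (cases e; simp)+
    have "?C \<subseteq> ?r ` centre"
    proof
      fix c assume "c \<in> ?C"
      then obtain g where g: "g \<in> carrier G" "c = g [^] int (p ^ e)" unfolding im_eq[symmetric] by blast
      then have "c = ?r (g [^] int p)" by (simp only: int_pow_pow pe(1))
      then show "c \<in> ?r ` centre" using pow_p_centre[OF g(1)] by blast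
    qed
    then have 1: "p ^ 3 \<le> card (?r ` centre)"
      using card_mono[of "?r ` centre" ?C] finite_subgroup[OF centre_subgroup] card_C by simp
    have "?C \<subseteq> kernel ?Z G ?r"
    proof
      fix c assume c: "c \<in> ?C"
      then have "c [^] int p = \<one>" "c \<in> carrier G" by (auto elim!: comm_spanE simp: comms_pow_p)
      then have "?r c = \<one>" using pe(2) by (elim dvdE) (simp only: int_pow_pow[symmetric] int_pow_one)
      then show "c \<in> kernel ?Z G ?r" using c C_Z by (auto simp: kernel_def)
    qed
    then have 2: "p ^ 3 \<le> card (kernel ?Z G ?r)"
      using card_mono[of "kernel ?Z G ?r" ?C] finite_subgroup[OF centre_subgroup] card_C by (simp add: kernel_def)
    have "p ^ 3 * p ^ 3 \<le> p ^ 4"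
      using mult_le_mono[OF 1 2] eq card_Z by linarith
    then show False using p_gt_1 by (simp add: power_add[symmetric])
  qed
  \<comment> \<open>The default \<open>s = \<one>\<close> serves when the centre is the commutator
    span; otherwise one proper step from \<open>p^3\<close> already fills
    \<open>p^4\<close>.\<close>
  have ex_s: "\<exists>s\<in>centre. adjoin ?C s = centre \<and> (s = \<one> \<or> s \<notin> ?C)"
  proof (cases "?C = centre")
    case True
    have "adjoin ?C \<one> = ?C"
    proof
      show "adjoin ?C \<one> \<subseteq> ?C" by (auto elim!: adjoinE comm_spanE)
      show "?C \<subseteq> adjoin ?C \<one>" by (rule subset_adjoin[OF subgroup.subset[OF comm_span_subgroup]]) simp_all
    qed
    then show ?thesis using True by (intro bexI[of _ \<one>]) (auto simp: subgroup.one_closed[OF centre_subgroup])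
  next
    case False
    then obtain s where s: "s \<in> centre" "s \<notin> ?C" using C_Z by blast
    have Csub: "subgroup ?C G" by (rule comm_span_subgroup) simp_all
    have sub: "adjoin ?C s \<subseteq> centre"
      using C_Z s by (auto elim!: adjoinE intro!: centre_mult centre_int_pow)
    have "p * p ^ 3 \<le> card (adjoin ?C s)"
      using card_adjoin[OF Csub D centre_carrier[OF s(1)] s(2)] by (simp add: card_C)
    then have "adjoin ?C s = centre"
      using card_Z card_mono[OF finite_subgroup[OF centre_subgroup] sub]
      by (intro card_subset_eq finite_subgroup[OF centre_subgroup] sub) (simp add: power_numeral_reduce)
    with s show ?thesis by blast
  qed
  then obtain s where s: "s \<in> centre" "adjoin ?C s = centre" "s = \<one> \<or> s \<notin> ?C" by blast
  have Z_pow: "z [^] int p = \<one>" if "z \<in> centre" for z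
    using that ker_eq \<open>e = 1\<close> by (auto simp: kernel_def)
  show ?thesis
  proof (rule that[of x y w s])
    show "(\<lambda>g. g [^] int p) \<in> hom G G" "(\<lambda>g. g [^] int p) ` carrier G = ?C"
      using e(1) im_eq by (simp_all add: \<open>e = 1\<close>)
  next
    fix g assume "g \<in> carrier G"
    then obtain i j l z where z: "z \<in> centre" "g = gens x y w i j l \<otimes> z" using gen by blast
    obtain c n where c: "c \<in> ?C" "z = c \<otimes> s [^] (n::int)" using z(1) unfolding s(2)[symmetric] by (rule adjoinE)
    obtain a b d where "c = comms x y w a b d" using c(1) by (rule comm_spanE)
    then have "g = gens x y w i j l \<otimes> comms x y w a b d \<otimes> s [^] n"
      using s(1) by (simp add: z c(2) m_assoc centre_carrier)
    then show "\<exists>i j l a b d n. g = gens x y w i j l \<otimes> comms x y w a b d \<otimes> s [^] (n::int)" by blast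
  next
    \<comment> \<open>If \<open>p\<close> does not divide \<open>n\<close>, then \<open>s\<close> is
      a power of \<open>s^n\<close> and lies in \<open>?C\<close>, so it is the default
      \<open>\<one>\<close>.\<close>
    fix n :: int assume n: "s [^] n \<in> ?C"
    show "s [^] n = \<one>"
    proof (cases "int p dvd n")
      case True
      then show ?thesis using Z_pow[OF s(1)] centre_carrier[OF s(1)]
        by (elim dvdE) (simp add: int_pow_pow[symmetric])
    next
      case False
      have sc: "s \<in> carrier G" using s(1) by (rule centre_carrier)
      have Csub: "subgroup ?C G" by (rule comm_span_subgroup) simp_all
      have "coprime (int p) n" using False prime_p by (intro prime_imp_coprime) simp_all
      then obtain u v where "u * int p + v * n = 1"
        using bezout_int[of "int p" n] by (metis coprime_iff_gcd_eq_1)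
      then have "s = s [^] (int p * u + n * v)" using sc by (simp add: mult.commute)
      also have "\<dots> = (s [^] int p) [^] u \<otimes> (s [^] n) [^] v"
        using sc by (simp add: int_pow_mult int_pow_pow)
      also have "\<dots> = (s [^] n) [^] v" using sc Z_pow[OF s(1)] by simp
      also have "\<dots> \<in> ?C" by (rule subgroup_int_pow_closed[OF Csub n])
      finally show ?thesis using s(3) by auto
    qed
  qed (use s(1) indep Z_pow in auto)
qed

end

section \<open>Similitudes of ternary bilinear forms modulo p\<close>

text \<open>Row and column indices of \<open>3 \<times> 3\<close> matrices are read modulo 3, so that the cyclic formula
  for cofactors carries the correct signs.\<close>
definition mprod :: "(nat \<Rightarrow> nat \<Rightarrow> int) \<Rightarrow> (nat \<Rightarrow> nat \<Rightarrow> int) \<Rightarrow> nat \<Rightarrow> nat \<Rightarrow> int" where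
  "mprod A B i k = A i 0 * B 0 k + A i 1 * B 1 k + A i 2 * B 2 k"

definition cof :: "(nat \<Rightarrow> nat \<Rightarrow> int) \<Rightarrow> nat \<Rightarrow> nat \<Rightarrow> int" where
  "cof A i k = A ((i + 1) mod 3) ((k + 1) mod 3) * A ((i + 2) mod 3) ((k + 2) mod 3)
    - A ((i + 1) mod 3) ((k + 2) mod 3) * A ((i + 2) mod 3) ((k + 1) mod 3)"

definition det :: "(nat \<Rightarrow> nat \<Rightarrow> int) \<Rightarrow> int" where
  "det A = A 0 0 * cof A 0 0 + A 0 1 * cof A 0 1 + A 0 2 * cof A 0 2"

definition scalar_mod :: "int \<Rightarrow> (nat \<Rightarrow> nat \<Rightarrow> int) \<Rightarrow> bool" where
  "scalar_mod p A \<longleftrightarrow> (\<forall>i<3. \<forall>k<3. i \<noteq> k \<longrightarrow> p dvd A i k \<and> p dvd A i i - A k k)"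

lemma all_less_3: "(\<forall>i<3. P i) \<longleftrightarrow> P 0 \<and> P 1 \<and> P (2::nat)"
  by (auto simp: numeral_3_eq_3 numeral_2_eq_2 less_Suc_eq)

lemma cof_simps:
  "cof A 0 0 = A (Suc 0) (Suc 0) * A 2 2 - A (Suc 0) 2 * A 2 (Suc 0)" "cof A 0 (Suc 0) = A (Suc 0) 2 * A 2 0 - A (Suc 0) 0 * A 2 2"
  "cof A 0 2 = A (Suc 0) 0 * A 2 (Suc 0) - A (Suc 0) (Suc 0) * A 2 0" "cof A (Suc 0) 0 = A 2 (Suc 0) * A 0 2 - A 2 2 * A 0 (Suc 0)"
  "cof A (Suc 0) (Suc 0) = A 2 2 * A 0 0 - A 2 0 * A 0 2" "cof A (Suc 0) 2 = A 2 0 * A 0 (Suc 0) - A 2 (Suc 0) * A 0 0"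
  "cof A 2 0 = A 0 (Suc 0) * A (Suc 0) 2 - A 0 2 * A (Suc 0) (Suc 0)" "cof A 2 (Suc 0) = A 0 2 * A (Suc 0) 0 - A 0 0 * A (Suc 0) 2"
  "cof A 2 2 = A 0 0 * A (Suc 0) (Suc 0) - A 0 (Suc 0) * A (Suc 0) 0"
  by (simp_all add: cof_def numeral_2_eq_2)

lemma det_mprod: "det (mprod A B) = det A * det B"
  by (simp add: det_def cof_simps mprod_def[abs_def] algebra_simps)

text \<open>The matrix \<open>B\<^sup>T adj B\<close> is a multiple of the asymmetry \<open>B\<^sup>T B\<^sup>-\<^sup>1\<close> of the bilinear form \<open>B\<close>.\<close>
lemma asymmetry_similitude:
  defines "M \<equiv> \<lambda>B i k. mprod (\<lambda>i j. B j i) (\<lambda>j k. cof B k j) i k"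
  assumes "i < 3" "k < 3"
  shows "mprod (M B) B i k = det B * B k i" "mprod B (cof (M B)) i k = det B ^ 2 * B k i"
proof -
  have "\<forall>i<3. \<forall>k<3. mprod (M B) B i k = det B * B k i"
    unfolding all_less_3 by (simp add: M_def mprod_def det_def cof_simps algebra_simps)
  with assms show "mprod (M B) B i k = det B * B k i" by blast
  have "\<forall>i<3. \<forall>k<3. mprod B (cof (M B)) i k = det B ^ 2 * B k i"
    unfolding all_less_3 by (simp add: M_def mprod_def det_def cof_simps power2_eq_square algebra_simps)
  with assms show "mprod B (cof (M B)) i k = det B ^ 2 * B k i" by blast
qed

text \<open>A multiple of the half turn \<open>x \<mapsto> 2 B(x, v) / B(v, v) v - x\<close>.\<close>
lemma half_turn_similitude:
  fixes v :: "nat \<Rightarrow> int" and B :: "nat \<Rightarrow> nat \<Rightarrow> int"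
  defines "r \<equiv> \<lambda>i. B i 0 * v 0 + B i 1 * v 1 + B i 2 * v 2"
  defines "n \<equiv> v 0 * r 0 + v 1 * r 1 + v 2 * r 2"
  defines "M \<equiv> \<lambda>i k. 2 * r i * v k - (if i = k then n else 0)"
  assumes "i < 3" "k < 3"
  shows "mprod M B i k = 2 * r i * (v 0 * B 0 k + v 1 * B 1 k + v 2 * B 2 k) - n * B i k"
    "mprod B (cof M) i k = 2 * n * r i * r k - n ^ 2 * B i k"
proof -
  have "\<forall>i<3. \<forall>k<3. mprod M B i k = 2 * r i * (v 0 * B 0 k + v 1 * B 1 k + v 2 * B 2 k) - n * B i k"
    unfolding all_less_3 by (simp add: M_def mprod_def algebra_simps)
  with assms show "mprod M B i k = 2 * r i * (v 0 * B 0 k + v 1 * B 1 k + v 2 * B 2 k) - n * B i k" by blast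
  have "\<forall>i<3. \<forall>k<3. cof M i k = 2 * n * v i * r k - (if i = k then n ^ 2 else 0)"
    unfolding all_less_3 by (simp add: M_def cof_simps n_def power2_eq_square algebra_simps)
  then have "\<forall>i<3. \<forall>k<3. mprod B (cof M) i k = 2 * n * r i * r k - n ^ 2 * B i k"
    unfolding all_less_3 by (simp add: mprod_def) (simp add: r_def algebra_simps)
  with assms show "mprod B (cof M) i k = 2 * n * r i * r k - n ^ 2 * B i k" by blast
qed

lemma inverse_mod_prime:
  fixes p a :: int
  assumes "Factorial_Ring.prime p" "\<not> p dvd a"
  obtains c where "p dvd 1 - c * a"
proof -
  have "coprime p a" using assms by (rule prime_imp_coprime)
  then obtain u c where "u * p + c * a = 1"
    using bezout_int[of p a] by (metis coprime_iff_gcd_eq_1)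
  then have "1 - c * a = p * u" by (simp add: algebra_simps)
  then show ?thesis by (intro that[of c]) simp
qed

text \<open>A linear map \<open>M\<close> of \<open>G/Z\<close> acts on \<open>G'\<close>, the exterior square, by its cofactor matrix, so
  \<open>M B = B cof M\<close> expresses compatibility with the \<open>p\<close>-power map \<open>B\<close>.\<close>
lemma nonscalar_similitude:
  fixes p :: int and B :: "nat \<Rightarrow> nat \<Rightarrow> int"
  assumes p: "Factorial_Ring.prime p" "\<not> p dvd 2" and det: "\<not> p dvd det B"
  obtains M where "\<And>i k. i < 3 \<Longrightarrow> k < 3 \<Longrightarrow> p dvd mprod M B i k - mprod B (cof M) i k" "\<not> scalar_mod p M"
proof -
  \<comment> \<open>The factor \<open>d\<close> turns \<open>B^T adj B\<close> into the asymmetry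
    itself, of determinant 1. The scale matters because \<open>cof\<close> is quadratic in the
    matrix.\<close>
  obtain d where d: "p dvd 1 - d * det B" using inverse_mod_prime[OF p(1) det] .
  define A where "A i k = mprod (\<lambda>i j. B j i) (\<lambda>j k. cof B k j) i k" for i k
  define M where "M i k = d * A i k" for i k
  have A: "mprod A B i k = det B * B k i" "mprod B (cof A) i k = det B ^ 2 * B k i" if "i < 3" "k < 3" for i k
    using asymmetry_similitude[OF that, of B] by (simp_all add: A_def[abs_def])
  have M: "mprod M B i k = d * mprod A B i k" "mprod B (cof M) i k = d ^ 2 * mprod B (cof A) i k" for i k
    by (simp_all add: M_def mprod_def cof_def power2_eq_square algebra_simps)
  have MB: "p dvd mprod M B i k - mprod B (cof M) i k" if "i < 3" "k < 3" for i k
  proof -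
    have "mprod M B i k - mprod B (cof M) i k = (1 - d * det B) * (d * det B * B k i)"
      by (simp add: M A[OF that] power2_eq_square algebra_simps)
    with d show ?thesis by simp
  qed
  show ?thesis
  proof (cases "scalar_mod p M")
    case False
    with MB show ?thesis by (rule that)
  next
    case True
    \<comment> \<open>A scalar asymmetry \<open>c\<close> means that the transpose of
      \<open>B\<close> is \<open>c B\<close> mod \<open>p\<close>. Transposing twice gives
      \<open>c^2 = 1\<close>.\<close>
    define c where "c = M 0 0"
    have Mc: "p dvd M i k - (if i = k then c else 0)" if "i < 3" "k < 3" for i k
    proof (cases "i = k")
      case True
      have "p dvd M k k - M 0 0" if "k \<noteq> 0"
        using \<open>scalar_mod p M\<close> \<open>k < 3\<close> that unfolding scalar_mod_def by (metis zero_less_numeral)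
      with True show ?thesis by (cases "k = 0") (auto simp: c_def)
    qed (use \<open>scalar_mod p M\<close> that in \<open>auto simp: scalar_mod_def\<close>)
    have sym_c: "p dvd B k i - c * B i k" if ik: "i < 3" "k < 3" for i k
    proof -
      let ?e = "\<lambda>j. M i j - (if i = j then c else 0)"
      have "c * B i k = (if i = 0 then c else 0) * B 0 k + (if i = 1 then c else 0) * B 1 k + (if i = 2 then c else 0) * B 2 k"
        using ik by (auto simp: numeral_3_eq_3 numeral_2_eq_2 less_Suc_eq)
      moreover have "mprod M B i k = d * det B * B k i" using A[OF ik] M by simp
      ultimately have "B k i - c * B i k = (1 - d * det B) * B k i + (?e 0 * B 0 k + ?e 1 * B 1 k + ?e 2 * B 2 k)"
        by (simp add: mprod_def algebra_simps)
      then show ?thesis using d Mc[OF ik(1)] by (simp add: dvd_add dvd_mult2)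
    qed
    have sq: "p dvd (c ^ 2 - 1) * B i k" if ik: "i < 3" "k < 3" for i k
    proof -
      have "p dvd (B i k - c * B k i) + c * (B k i - c * B i k)"
        using sym_c[OF ik] sym_c[OF ik(2,1)] by (intro dvd_add dvd_mult)
      also have "\<dots> = - ((c ^ 2 - 1) * B i k)"
        by (simp add: power2_eq_square algebra_simps)
      finally show ?thesis by (simp only: dvd_minus_iff)
    qed
    have ex: "\<exists>i<3. \<exists>k<3. \<not> p dvd B i k"
    proof (rule ccontr)
      assume "\<not> ?thesis"
      then have "p dvd B 0 0" "p dvd B 0 1" "p dvd B 0 2" by auto
      then have "p dvd det B" by (simp add: det_def)
      with det show False ..
    qed
    then have c2: "p dvd c ^ 2 - 1" using sq prime_dvd_multD[OF p(1)] by blast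
    \<comment> \<open>Odd dimension decides the sign: determinants give \<open>c^3 = 1\<close>, so
      \<open>c = 1\<close>, and the alternating case \<open>c = -1\<close> is excluded.\<close>
    have "det (\<lambda>i k. B k i) mod p = det (\<lambda>i k. c * B i k) mod p"
    proof -
      have "B k i mod p = (c * B i k) mod p" if "i < 3" "k < 3" for i k
        using sym_c[OF that] by (simp add: mod_eq_dvd_iff)
      then show ?thesis
        unfolding det_def One_nat_def cof_simps by (intro mod_add_cong mod_mult_cong mod_diff_cong) auto
    qed
    then have "p dvd (1 - c ^ 3) * det B"
      by (simp add: mod_eq_dvd_iff det_def cof_simps power3_eq_cube algebra_simps)
    then have "p dvd 1 - c ^ 3" using prime_dvd_multD[OF p(1)] det by blast
    with c2 have "p dvd - ((1 - c ^ 3) + c * (c ^ 2 - 1))"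
      unfolding dvd_minus_iff by (intro dvd_add dvd_mult)
    then have "p dvd c - 1" by (simp add: power2_eq_square power3_eq_cube algebra_simps)
    have sym: "p dvd B k i - B i k" if ik: "i < 3" "k < 3" for i k
    proof -
      have "p dvd (B k i - c * B i k) + (c - 1) * B i k"
        using sym_c[OF ik] \<open>p dvd c - 1\<close> by (intro dvd_add dvd_mult2)
      then show ?thesis by (simp add: algebra_simps)
    qed
    define r where "r v i = B i 0 * v 0 + B i 1 * v 1 + B i 2 * v 2" for v :: "nat \<Rightarrow> int" and i :: nat
    define n where "n v = v 0 * r v 0 + v 1 * r v 1 + v 2 * r v 2" for v :: "nat \<Rightarrow> int"
    \<comment> \<open>Polarization: for odd \<open>p\<close>, a symmetric form whose quadratic form
      vanishes is itself zero.\<close>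
    have "\<exists>v. \<not> p dvd n v"
    proof (rule ccontr)
      assume "\<not> ?thesis"
      then have all: "p dvd n v" for v by blast
      have dg: "p dvd B i i" if "i < 3" for i
        using all[of "\<lambda>j. if j = i then 1 else 0"] that
        by (auto simp: n_def r_def numeral_3_eq_3 numeral_2_eq_2 less_Suc_eq)
      have "p dvd B i k" if ik: "i < 3" "k < 3" for i k
      proof (cases "i = k")
        case False
        have "n (\<lambda>j. if j = i \<or> j = k then 1 else 0) = B i i + B i k + B k i + B k k"
          using that False by (auto simp: n_def r_def numeral_3_eq_3 numeral_2_eq_2 less_Suc_eq)
        then have "2 * B i k = n (\<lambda>j. if j = i \<or> j = k then 1 else 0) - B i i - B k k - (B k i - B i k)"
          by simp
        also have "p dvd \<dots>" by (rule dvd_diff[OF dvd_diff[OF dvd_diff[OF all dg[OF ik(1)]] dg[OF ik(2)]] sym[OF ik]])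
        finally show ?thesis using prime_dvd_multD[OF p(1)] p(2) by blast
      qed (use dg ik in simp)
      with ex show False by blast
    qed
    then obtain v where nv: "\<not> p dvd n v" ..
    obtain b where b: "p dvd 1 - b * n v" using inverse_mod_prime[OF p(1) nv] .
    have nb: "\<not> p dvd b"
    proof
      assume "p dvd b"
      then have "p dvd (1 - b * n v) + b * n v" using b by (intro dvd_add) auto
      then have "p dvd 1" by simp
      with p(1) show False using not_prime_unit by blast
    qed
    define H where "H i k = 2 * r v i * v k - (if i = k then n v else 0)" for i k :: nat
    \<comment> \<open>\<open>H\<close> is \<open>n v\<close> times the half turn about
      \<open>v\<close>. Division by \<open>n v\<close> restores determinant 1, again because
      \<open>cof\<close> is quadratic.\<close>
    define M' where "M' i k = b * H i k" for i k
    have H: "mprod H B i k = 2 * r v i * (v 0 * B 0 k + v 1 * B 1 k + v 2 * B 2 k) - n v * B i k"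
      "mprod B (cof H) i k = 2 * n v * r v i * r v k - n v ^ 2 * B i k" if "i < 3" "k < 3" for i k
      unfolding H_def[abs_def] n_def r_def by (rule half_turn_similitude[OF that, of B v])+
    have M': "mprod M' B i k = b * mprod H B i k" "mprod B (cof M') i k = b ^ 2 * mprod B (cof H) i k" for i k
      by (simp_all add: M'_def mprod_def cof_def power2_eq_square algebra_simps)
    show ?thesis
    proof (rule that[of M'])
      fix i k :: nat assume ik: "i < 3" "k < 3"
      have "mprod M' B i k - mprod B (cof M') i k =
        2 * b * r v i * ((B 0 k - B k 0) * v 0 + (B 1 k - B k 1) * v 1 + (B 2 k - B k 2) * v 2)
        + (2 * b * r v i * r v k - b * n v * B i k) * (1 - b * n v)"
        unfolding M' H[OF ik] by (simp add: r_def[of v k] power2_eq_square algebra_simps)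
      moreover have "p dvd (B 0 k - B k 0) * v 0 + (B 1 k - B k 1) * v 1 + (B 2 k - B k 2) * v 2"
        using sym ik by (intro dvd_add dvd_mult2) auto
      ultimately show "p dvd mprod M' B i k - mprod B (cof M') i k"
        using b by simp
    next
      \<comment> \<open>Up to a scalar matrix, \<open>M'\<close> is the rank one matrix with entries
        \<open>2 b r_i v_k\<close>. Were it scalar, all products \<open>r_i v_k\<close> would vanish
        mod \<open>p\<close>, and with them the trace \<open>n v\<close>.\<close>
      show "\<not> scalar_mod p M'"
      proof
        assume sc: "scalar_mod p M'"
        have off: "p dvd r v i * v k" if "i < 3" "k < 3" "i \<noteq> k" for i k
        proof -
          have "p dvd M' i k" using sc that by (auto simp: scalar_mod_def)
          then have "p dvd b * (2 * (r v i * v k))" using that by (simp add: M'_def H_def mult.assoc)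
          then show ?thesis using prime_dvd_multD[OF p(1)] p(2) nb by blast
        qed
        have dg: "p dvd r v i * v i - r v k * v k" if "i < 3" "k < 3" for i k
        proof (cases "i = k")
          case False
          have "p dvd M' i i - M' k k" using sc that False by (auto simp: scalar_mod_def)
          then have "p dvd b * (2 * (r v i * v i - r v k * v k))"
            by (simp add: M'_def H_def algebra_simps)
          then show ?thesis using prime_dvd_multD[OF p(1)] p(2) nb by blast
        qed simp
        have z: "p dvd r v i * v i" if i: "i < 3" for i
        proof -
          obtain k where k: "k < 3" "k \<noteq> i" by (metis less_numeral_extra(1) one_less_numeral_iff semiring_norm(77) zero_less_numeral zero_neq_one)
          have "(r v i * v i) ^ 2 = r v i * v i * (r v i * v i - r v k * v k) + (r v i * v k) * (r v k * v i)"
            by (simp add: power2_eq_square algebra_simps)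
          moreover have "p dvd \<dots>" using k(2) by (intro dvd_add[OF dvd_mult[OF dg[OF i k(1)]] dvd_mult2[OF off[OF i k(1)]]]) simp
          ultimately show ?thesis using prime_dvd_power[OF p(1)] by metis
        qed
        have "p dvd n v" unfolding n_def using z[of 0] z[of 1] z[of 2]
          by (intro dvd_add) (simp_all add: mult.commute)
        with nv show False ..
      qed
    qed
  qed
qed

section \<open>Endomorphisms from similitudes\<close>

context class2_group begin

text \<open>The product formula has the same exponents for every triple \<open>x\<close>,
  \<open>y\<close>, \<open>w\<close>. In \<open>inconsistent\<close> it is used for the generators
  and for their images, which makes the relation there multiplicative.\<close>

lemma gens_comms_mult:
  assumes [simp]: "x \<in> carrier G" "y \<in> carrier G" "w \<in> carrier G"
  shows "(gens x y w i j l \<otimes> comms x y w a b d) \<otimes> (gens x y w i' j' l' \<otimes> comms x y w a' b' d') =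
    gens x y w (i + i') (j + j') (l + l') \<otimes> comms x y w (a + a' - l * j') (b + b' + l * i') (d + d' - j * i')"
proof -
  have "(gens x y w i j l \<otimes> comms x y w a b d) \<otimes> (gens x y w i' j' l' \<otimes> comms x y w a' b' d')
    = gens x y w i j l \<otimes> (comms x y w a b d \<otimes> gens x y w i' j' l') \<otimes> comms x y w a' b' d'"
    by (simp add: m_assoc)
  also have "\<dots> = (gens x y w i j l \<otimes> gens x y w i' j' l') \<otimes> (comms x y w a b d \<otimes> comms x y w a' b' d')"
    by (simp add: m_assoc centre_left_commute[OF comms_centre[OF assms], of "gens x y w i' j' l'"])
  also have "\<dots> = gens x y w (i + i') (j + j') (l + l') \<otimes> comms x y w (a + a' - l * j') (b + b' + l * i') (d + d' - j * i')"
    by (simp add: gens_mult comms_mult m_assoc algebra_simps)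
  finally show ?thesis .
qed

lemma gens_of_comms:
  assumes [simp]: "x \<in> carrier G" "y \<in> carrier G" "w \<in> carrier G"
  shows "gens (comms x y w a b d) (comms x y w a' b' d') (comms x y w a'' b'' d'') i j l =
    comms x y w (i * a + j * a' + l * a'') (i * b + j * b' + l * b'') (i * d + j * d' + l * d'')"
  by (simp add: gens_def comms_int_pow comms_mult algebra_simps)

end

lemma (in small_pE_group) comms_cong:
  assumes "x \<in> carrier G" "y \<in> carrier G" "w \<in> carrier G"
    and "int p dvd a - a'" "int p dvd b - b'" "int p dvd d - d'"
  shows "comms x y w a b d = comms x y w a' b' d'"
  using assms comms_mod[OF assms(1-3), of a b d] comms_mod[OF assms(1-3), of a' b' d']
  by (simp add: mod_eq_dvd_iff[symmetric])

text \<open>\<open>B\<close> is the matrix of the \<open>p\<close>-power map in the coordinates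
  \<open>gens\<close> and \<open>comms\<close>. A nonscalar similitude \<open>M\<close> of
  \<open>B\<close> defines an endomorphism sending \<open>x\<close>, \<open>y\<close>,
  \<open>w\<close> to the elements whose exponents are the rows of \<open>M\<close>, whereas the
  E-condition forces \<open>M\<close> to be scalar.\<close>

lemma (in small_pE_group) inconsistent: False
proof -
  obtain x y w s where xyw [simp]: "x \<in> carrier G" "y \<in> carrier G" "w \<in> carrier G" and s: "s \<in> centre"
    and nf: "\<And>g. g \<in> carrier G \<Longrightarrow> \<exists>i j l a b d n. g = gens x y w i j l \<otimes> comms x y w a b d \<otimes> s [^] (n::int)"
    and indep: "\<And>a b d. comms x y w a b d = \<one> \<Longrightarrow> int p dvd a \<and> int p dvd b \<and> int p dvd d"
    and s_span: "\<And>n::int. s [^] n \<in> comm_span x y w \<Longrightarrow> s [^] n = \<one>"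
    and P: "(\<lambda>g. g [^] int p) \<in> hom G G" "(\<lambda>g. g [^] int p) ` carrier G = comm_span x y w"
    and Zp: "\<And>z. z \<in> centre \<Longrightarrow> z [^] int p = \<one>"
    by (rule normal_form) blast
  have [simp]: "s \<in> carrier G" using s by (rule centre_carrier)
  have indep': "int p dvd a - a' \<and> int p dvd b - b' \<and> int p dvd d - d'"
    if "comms x y w a b d = comms x y w a' b' d'" for a b d a' b' d'
  proof (rule indep)
    have "comms x y w a b d \<otimes> inv (comms x y w a' b' d') = \<one>" by (simp add: that)
    then show "comms x y w (a - a') (b - b') (d - d') = \<one>" by (simp add: inv_comms comms_mult)
  qed
  define r where "r i = (if i = 0 then x else if i = 1 then y else w)" for i :: nat
  have "\<exists>a b d. r i [^] int p = comms x y w a b d" for i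
  proof -
    have "r i [^] int p \<in> comm_span x y w" unfolding P(2)[symmetric] by (simp add: r_def)
    then show ?thesis by (blast elim: comm_spanE)
  qed
  then obtain b0 b1 b2 where b: "\<And>i. r i [^] int p = comms x y w (b0 i) (b1 i) (b2 i)" by metis
  define B where "B i k = (if k = 0 then b0 i else if k = 1 then b1 i else b2 i)" for i k :: nat
  have B: "x [^] int p = comms x y w (B 0 0) (B 0 1) (B 0 2)" "y [^] int p = comms x y w (B 1 0) (B 1 1) (B 1 2)"
    "w [^] int p = comms x y w (B 2 0) (B 2 1) (B 2 2)"
    using b[of 0] b[of 1] b[of 2] by (simp_all add: r_def B_def)
  interpret P: group_hom G G "\<lambda>g. g [^] int p" using P(1) by unfold_locales
  have gens_p: "gens x y w i j l [^] int p = comms x y w (i * B 0 0 + j * B 1 0 + l * B 2 0)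
      (i * B 0 1 + j * B 1 1 + l * B 2 1) (i * B 0 2 + j * B 1 2 + l * B 2 2)" for i j l
  proof -
    have "gens x y w i j l [^] int p = gens (x [^] int p) (y [^] int p) (w [^] int p) i j l"
      using P.hom_int_pow[of x i] P.hom_int_pow[of y j] P.hom_int_pow[of w l] by (simp add: gens_def P.hom_mult)
    then show ?thesis by (simp add: B gens_of_comms)
  qed
  \<comment> \<open>The \<open>p\<close>-power map is onto the commutator span, so preimages of the
    basic commutators are the rows of a matrix \<open>N\<close> with \<open>N B = 1\<close> mod
    \<open>p\<close>.\<close>
  have detB: "\<not> int p dvd det B"
  proof -
    have "\<exists>i j l. comms x y w a b d = gens x y w i j l [^] int p" for a b d
    proof -
      have "comms x y w a b d \<in> (\<lambda>g. g [^] int p) ` carrier G" unfolding P(2) by simp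
      then obtain g where g: "g \<in> carrier G" "comms x y w a b d = g [^] int p" by blast
      obtain i j l a' b' d' n where g': "g = gens x y w i j l \<otimes> comms x y w a' b' d' \<otimes> s [^] (n::int)"
        using nf[OF g(1)] by blast
      have "g [^] int p = gens x y w i j l [^] int p"
        unfolding g' by (simp add: P.hom_mult Zp comms_centre centre_int_pow s)
      with g(2) show ?thesis by metis
    qed
    then obtain n0 n1 n2 where n: "\<And>a b d. comms x y w a b d = gens x y w (n0 a b d) (n1 a b d) (n2 a b d) [^] int p"
      by metis
    define e where "e i k = (if i = k then 1 else 0 :: int)" for i k :: nat
    define N where "N i k = (if k = 0 then n0 (e i 0) (e i 1) (e i 2) else if k = 1 then n1 (e i 0) (e i 1) (e i 2)
        else n2 (e i 0) (e i 1) (e i 2))" for i k :: nat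
    have NB: "int p dvd e i k - mprod N B i k" if "k < 3" for i k
      using indep'[OF n[of "e i 0" "e i 1" "e i 2", unfolded gens_p]] that
      by (auto simp: mprod_def N_def numeral_3_eq_3 numeral_2_eq_2 less_Suc_eq)
    have "det e mod int p = det (mprod N B) mod int p"
      using NB unfolding det_def One_nat_def cof_simps
      by (intro mod_add_cong mod_mult_cong mod_diff_cong) (auto simp: mod_eq_dvd_iff)
    moreover have "det e = 1" by (simp add: det_def cof_simps e_def)
    ultimately have NB1: "int p dvd 1 - det N * det B" by (simp add: det_mprod mod_eq_dvd_iff)
    show ?thesis
    proof
      assume "int p dvd det B"
      then have "int p dvd (1 - det N * det B) + det N * det B" by (intro dvd_add NB1 dvd_mult)
      then show False using p_gt_1 by simp
    qed
  qed
  have "Factorial_Ring.prime (int p)" using prime_p by simp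
  moreover have "\<not> int p dvd 2"
    using odd_p prime_p primes_dvd_imp_eq[of p 2] by (metis even_numeral of_nat_dvd_iff of_nat_numeral two_is_prime_nat)
  ultimately obtain M where M: "\<And>i k. i < 3 \<Longrightarrow> k < 3 \<Longrightarrow> int p dvd mprod M B i k - mprod B (cof M) i k"
    and M_ns: "\<not> scalar_mod (int p) M"
    using nonscalar_similitude[OF _ _ detB] by blast
  define A1 A2 A3 where A: "A1 = gens x y w (M 0 0) (M 0 1) (M 0 2)" "A2 = gens x y w (M 1 0) (M 1 1) (M 1 2)"
    "A3 = gens x y w (M 2 0) (M 2 1) (M 2 2)"
  have [simp]: "A1 \<in> carrier G" "A2 \<in> carrier G" "A3 \<in> carrier G" by (simp_all add: A)
  \<comment> \<open>The action of \<open>M\<close> on the exterior square: commutators of the rows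
    of \<open>M\<close> have the rows of \<open>cof M\<close> as exponents.\<close>
  have comms_A: "comms A1 A2 A3 a b d = comms x y w (a * cof M 0 0 + b * cof M 1 0 + d * cof M 2 0)
      (a * cof M 0 1 + b * cof M 1 1 + d * cof M 2 1) (a * cof M 0 2 + b * cof M 1 2 + d * cof M 2 2)" for a b d
  proof -
    have "comm A2 A3 = comms x y w (cof M 0 0) (cof M 0 1) (cof M 0 2)"
      unfolding A One_nat_def cof_simps by (subst comm_gens_gens) (simp_all add: mult.commute)
    moreover have "comm A3 A1 = comms x y w (cof M 1 0) (cof M 1 1) (cof M 1 2)"
      unfolding A One_nat_def cof_simps by (subst comm_gens_gens) (simp_all add: mult.commute)
    moreover have "comm A1 A2 = comms x y w (cof M 2 0) (cof M 2 1) (cof M 2 2)"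
      unfolding A One_nat_def cof_simps by (subst comm_gens_gens) (simp_all add: mult.commute)
    ultimately show ?thesis by (simp add: comms_def[of A1] gens_of_comms)
  qed
  \<comment> \<open>Here \<open>M B = B cof M\<close> is used: the images satisfy the same
    \<open>p\<close>-power relations, with the same matrix \<open>B\<close>, as the
    generators.\<close>
  have row: "gens x y w (M i 0) (M i 1) (M i 2) [^] int p = comms A1 A2 A3 (B i 0) (B i 1) (B i 2)" if "i < 3" for i
    unfolding gens_p comms_A using M[OF that, of 0] M[OF that, of 1] M[OF that, of 2]
    by (intro comms_cong) (simp_all add: mprod_def)
  have A_p: "A1 [^] int p = comms A1 A2 A3 (B 0 0) (B 0 1) (B 0 2)" "A2 [^] int p = comms A1 A2 A3 (B 1 0) (B 1 1) (B 1 2)"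
    "A3 [^] int p = comms A1 A2 A3 (B 2 0) (B 2 1) (B 2 2)"
    using row[of 0] row[of 1] row[of 2] unfolding A[symmetric] by simp_all
  have gens_mult_p: "gens u1 u2 u3 (int p * i) (int p * j) (int p * l) = comms u1 u2 u3 (i * B 0 0 + j * B 1 0 + l * B 2 0)
      (i * B 0 1 + j * B 1 1 + l * B 2 1) (i * B 0 2 + j * B 1 2 + l * B 2 2)"
    if [simp]: "u1 \<in> carrier G" "u2 \<in> carrier G" "u3 \<in> carrier G"
      and u: "u1 [^] int p = comms u1 u2 u3 (B 0 0) (B 0 1) (B 0 2)" "u2 [^] int p = comms u1 u2 u3 (B 1 0) (B 1 1) (B 1 2)"
        "u3 [^] int p = comms u1 u2 u3 (B 2 0) (B 2 1) (B 2 2)"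
    for u1 u2 u3 i j l
  proof -
    have "gens u1 u2 u3 (int p * i) (int p * j) (int p * l) = gens (u1 [^] int p) (u2 [^] int p) (u3 [^] int p) i j l"
      by (simp add: gens_def int_pow_pow)
    also have "\<dots> = comms u1 u2 u3 (i * B 0 0 + j * B 1 0 + l * B 2 0)
      (i * B 0 1 + j * B 1 1 + l * B 2 1) (i * B 0 2 + j * B 1 2 + l * B 2 2)"
      unfolding u by (rule gens_of_comms) simp_all
    finally show ?thesis .
  qed
  \<comment> \<open>The factor \<open>s^n\<close> is sent to the identity, which is consistent
    because powers of \<open>s\<close> meet the commutator span trivially.\<close>
  let ?R = "{(gens x y w i j l \<otimes> comms x y w a b d \<otimes> s [^] n, gens A1 A2 A3 i j l \<otimes> comms A1 A2 A3 a b d) |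
    i j l a b d (n::int). True}"
  obtain f where f: "f \<in> hom G G" "\<And>g h. (g, h) \<in> ?R \<Longrightarrow> f g = h"
  proof (rule hom_of_graph[of ?R])
    show "?R \<subseteq> carrier G \<times> carrier G" by auto
  next
    fix g1 h1 g2 h2 assume "(g1, h1) \<in> ?R" "(g2, h2) \<in> ?R"
    then obtain i j l a b d n i' j' l' a' b' d' n' where
      g: "g1 = gens x y w i j l \<otimes> comms x y w a b d \<otimes> s [^] (n::int)" "g2 = gens x y w i' j' l' \<otimes> comms x y w a' b' d' \<otimes> s [^] (n'::int)"
      and h: "h1 = gens A1 A2 A3 i j l \<otimes> comms A1 A2 A3 a b d" "h2 = gens A1 A2 A3 i' j' l' \<otimes> comms A1 A2 A3 a' b' d'"
      by blast
    have "g1 \<otimes> g2 = ((gens x y w i j l \<otimes> comms x y w a b d) \<otimes> (gens x y w i' j' l' \<otimes> comms x y w a' b' d')) \<otimes> s [^] (n + n')"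
      unfolding g by (simp add: m_assoc int_pow_mult centre_left_commute[OF centre_int_pow[OF s], symmetric])
    also have "\<dots> = gens x y w (i + i') (j + j') (l + l') \<otimes> comms x y w (a + a' - l * j') (b + b' + l * i') (d + d' - j * i') \<otimes> s [^] (n + n')"
      by (simp only: gens_comms_mult xyw)
    finally have "g1 \<otimes> g2 = gens x y w (i + i') (j + j') (l + l') \<otimes> comms x y w (a + a' - l * j') (b + b' + l * i') (d + d' - j * i') \<otimes> s [^] (n + n')" .
    moreover have "h1 \<otimes> h2 = gens A1 A2 A3 (i + i') (j + j') (l + l') \<otimes> comms A1 A2 A3 (a + a' - l * j') (b + b' + l * i') (d + d' - j * i')"
      unfolding h by (rule gens_comms_mult) simp_all
    ultimately show "(g1 \<otimes> g2, h1 \<otimes> h2) \<in> ?R" by blast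
  next
    fix g assume "g \<in> carrier G"
    from nf[OF this] show "\<exists>h. (g, h) \<in> ?R" by blast
  next
    fix h assume "(\<one>, h) \<in> ?R"
    then obtain i j l a b d n where one: "\<one> = gens x y w i j l \<otimes> comms x y w a b d \<otimes> s [^] (n::int)"
      and h: "h = gens A1 A2 A3 i j l \<otimes> comms A1 A2 A3 a b d" by blast
    define z where "z = comms x y w a b d \<otimes> s [^] n"
    have z: "z \<in> centre" and [simp]: "z \<in> carrier G" by (simp_all add: z_def centre_mult comms_centre centre_int_pow s)
    have "gens x y w i j l \<otimes> z = \<one>" using one by (simp add: z_def m_assoc)
    then have "gens x y w i j l = inv z" by (simp add: inv_equality)
    then have "gens x y w i j l \<in> centre" using subgroup.m_inv_closed[OF centre_subgroup z] by simp
    \<comment> \<open>Commutators with \<open>x\<close> and \<open>y\<close> have exponents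
      \<open>(0, l, -j)\<close> and \<open>(-l, 0, i)\<close>, so all of \<open>i\<close>,
      \<open>j\<close>, \<open>l\<close> are divisible by \<open>p\<close>. The \<open>gens\<close>
      part then becomes \<open>comms\<close> by the \<open>p\<close>-power relations, on both sides
      with the same exponents.\<close>
    then have "comm (gens x y w i j l) (gens x y w 1 0 0) = \<one>" "comm (gens x y w i j l) (gens x y w 0 1 0) = \<one>"
      by (simp_all add: centre_iff)
    then have "int p dvd i \<and> int p dvd j \<and> int p dvd l"
      unfolding comm_gens_gens[OF xyw] using indep by fastforce
    then obtain i' j' l' where ijl: "i = int p * i'" "j = int p * j'" "l = int p * l'" by (meson dvdE)
    define c0 c1 c2 where c: "c0 = i' * B 0 0 + j' * B 1 0 + l' * B 2 0 + a" "c1 = i' * B 0 1 + j' * B 1 1 + l' * B 2 1 + b"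
      "c2 = i' * B 0 2 + j' * B 1 2 + l' * B 2 2 + d"
    have one': "comms x y w c0 c1 c2 \<otimes> s [^] n = \<one>"
      using one unfolding ijl gens_mult_p[OF xyw B] by (simp add: comms_mult c)
    then have "inv (s [^] n) = comms x y w c0 c1 c2" by (intro inv_equality) simp_all
    then have "s [^] n = inv (comms x y w c0 c1 c2)" using inv_inv[of "s [^] n"] by simp
    then have "s [^] n \<in> comm_span x y w" by (simp add: inv_comms)
    then have "s [^] n = \<one>" by (rule s_span)
    then have "comms x y w c0 c1 c2 = \<one>" using one' by simp
    then have "int p dvd c0 \<and> int p dvd c1 \<and> int p dvd c2" by (rule indep)
    then have "comms A1 A2 A3 c0 c1 c2 = comms A1 A2 A3 0 0 0" by (intro comms_cong) simp_all
    moreover have "h = comms A1 A2 A3 c0 c1 c2"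
      unfolding h ijl by (subst gens_mult_p) (simp_all add: A_p comms_mult c)
    ultimately show "h = \<one>" by simp
  qed (rule that)
  have fR: "f (gens x y w i j l) = gens A1 A2 A3 i j l" for i j l
  proof (rule f(2))
    have "(gens x y w i j l \<otimes> comms x y w 0 0 0 \<otimes> s [^] (0::int), gens A1 A2 A3 i j l \<otimes> comms A1 A2 A3 0 0 0) \<in> ?R" by blast
    then show "(gens x y w i j l, gens A1 A2 A3 i j l) \<in> ?R" by simp
  qed
  \<comment> \<open>The E-condition for an element with exponent vector \<open>v\<close>: the cross
    product of \<open>v\<close> and \<open>v M\<close> vanishes mod \<open>p\<close>.\<close>
  have E1: "comms x y w (j * gl - l * gj) (l * gi - i * gl) (i * gj - j * gi) = \<one>"
    if "gi = i * M 0 0 + j * M 1 0 + l * M 2 0" "gj = i * M 0 1 + j * M 1 1 + l * M 2 1" "gl = i * M 0 2 + j * M 1 2 + l * M 2 2"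
    for i j l gi gj gl
  proof -
    define g where "g = gens x y w i j l"
    have [simp]: "g \<in> carrier G" by (simp add: g_def)
    have "f g = gens A1 A2 A3 i j l" by (simp add: g_def fR)
    moreover have "comm g (f g) = \<one>"
      using E[OF f(1), of g] hom_in_carrier[OF f(1), of g] by (simp add: comm_eq_one_iff)
    ultimately have "\<one> = gens (comm g A1) (comm g A2) (comm g A3) i j l"
      by (simp add: comm_gens_r)
    also have "\<dots> = comms x y w (j * gl - l * gj) (l * gi - i * gl) (i * gj - j * gi)"
      unfolding g_def A comm_gens_gens[OF xyw] gens_of_comms[OF xyw] that
      by (simp add: algebra_simps)
    finally show ?thesis by simp
  qed
  \<comment> \<open>The positional instances fill \<open>j\<close>, \<open>i\<close>,
    \<open>l\<close> in this order. The unit vectors kill the off-diagonal entries; below, the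
    vectors \<open>(1,1,0)\<close> and \<open>(0,1,1)\<close> equate the diagonal ones.\<close>
  have off: "int p dvd M 1 2" "int p dvd M 1 0" "int p dvd M 0 2" "int p dvd M 0 1" "int p dvd M 2 1" "int p dvd M 2 0"
    using indep[OF E1[OF refl refl refl, of 1 0 0]] indep[OF E1[OF refl refl refl, of 0 1 0]] indep[OF E1[OF refl refl refl, of 0 0 1]]
    by simp_all
  have "int p dvd M 0 0 + M 1 0 - (M 0 1 + M 1 1)" "int p dvd M 1 1 + M 2 1 - (M 1 2 + M 2 2)"
    using indep[OF E1[OF refl refl refl, of 1 1 0]] indep[OF E1[OF refl refl refl, of 1 0 1]]
    by (simp_all add: dvd_diff_commute)
  moreover have diag: "int p dvd a - d" if "int p dvd a + b - (c + d)" "int p dvd b" "int p dvd c" for a b c d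
    using dvd_add[OF dvd_diff[OF that(1,2)] that(3)] by (simp add: algebra_simps)
  ultimately have d: "int p dvd M 0 0 - M 1 1" "int p dvd M 1 1 - M 2 2"
    using off by blast+
  have "int p dvd M 0 0 - M 2 2" using dvd_add[OF d] by simp
  with off d have "scalar_mod (int p) M"
    unfolding scalar_mod_def all_less_3 by (simp add: dvd_diff_commute)
  with M_ns show False ..
qed

lemma (in finite_pE_group) comm_group_if_small:
  assumes "odd p" "order G \<le> p ^ 7"
  shows "comm_group G"
proof (rule group_comm_groupI)
  fix x y assume xy: "x \<in> carrier G" "y \<in> carrier G"
  show "x \<otimes> y = y \<otimes> x"
  proof (rule ccontr)
    assume "x \<otimes> y \<noteq> y \<otimes> x"
    then have "comm x y \<noteq> \<one>" using xy by (simp add: comm_eq_one_iff)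
    then interpret small_pE_group G p
      using assms xy by unfold_locales blast+
    show False by (rule inconsistent)
  qed
qed

section \<open>A non-abelian 2E-group of order 128\<close>

text \<open>Keeps \<open>bit\<close> as a ring of sums and products, so that
  \<open>algebra_simps\<close> can normalise the polynomial identities below.\<close>

declare add_bit_eq_xor [simp del] mult_bit_eq_and [simp del]

type_synonym vec4 = "bit \<times> bit \<times> bit \<times> bit"
type_synonym vec3 = "bit \<times> bit \<times> bit"

text \<open>The coefficients were found by computer search; by \<open>rigid\<close> below, the resulting squaring map \<open>quad\<close>
  admits no endomorphism except 0 and the identity.\<close>
fun cocycle :: "vec4 \<Rightarrow> vec4 \<Rightarrow> vec3" where
  "cocycle (x0, x1, x2, x3) (y0, y1, y2, y3) =
    (x0 * y0 + x1 * y1 + x2 * y2 + x0 * y1 + x0 * y3 + x1 * y2 + x2 * y3,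
     x0 * y2 + x1 * y2 + x1 * y3 + x2 * y3,
     x3 * y3 + x1 * y2 + x1 * y3)"

text \<open>A bilinear map satisfies the 2-cocycle identity, which is associativity here. Since it
  need not be symmetric, the group can be non-abelian.\<close>

definition ext_group :: "(vec4 \<times> vec3) monoid" where
  "ext_group = \<lparr>carrier = UNIV, monoid.mult = (\<lambda>(v, w) (v', w'). (v + v', w + w' + cocycle v v')), one = (0, 0)\<rparr>"

lemma bit_double [simp]: "(a::bit) + a = 0"
  by (cases a) simp_all

lemma vec_double [simp]: "(v::vec4) + v = 0" "(w::vec3) + w = 0"
  by (cases v; cases w; simp add: zero_prod_def)+

lemma cocycle_add: "cocycle (u + v) w = cocycle u w + cocycle v w" "cocycle u (v + w) = cocycle u v + cocycle u w"
  by (cases u; cases v; cases w; simp add: algebra_simps)+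

lemma cocycle_zero [simp]: "cocycle 0 v = 0" "cocycle v 0 = 0"
  by (cases v; simp add: zero_prod_def)+

lemma ext_group_simps [simp]:
  "carrier ext_group = UNIV" "\<one>\<^bsub>ext_group\<^esub> = (0, 0)"
  "(v, w) \<otimes>\<^bsub>ext_group\<^esub> (v', w') = (v + v', w + w' + cocycle v v')"
  by (simp_all add: ext_group_def)

lemma group_ext_group: "group ext_group"
proof (rule groupI)
  fix x y z :: "vec4 \<times> vec3"
  show "x \<otimes>\<^bsub>ext_group\<^esub> y \<otimes>\<^bsub>ext_group\<^esub> z = x \<otimes>\<^bsub>ext_group\<^esub> (y \<otimes>\<^bsub>ext_group\<^esub> z)"
    by (cases x; cases y; cases z) (simp add: cocycle_add algebra_simps)
  obtain v w where x: "x = (v, w)" by (cases x)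
  have "(v, w + cocycle v v) \<otimes>\<^bsub>ext_group\<^esub> x = \<one>\<^bsub>ext_group\<^esub>"
    by (simp add: x add.assoc[of w]) (simp add: add.commute add.left_commute flip: add.assoc)
  then show "\<exists>y\<in>carrier ext_group. y \<otimes>\<^bsub>ext_group\<^esub> x = \<one>\<^bsub>ext_group\<^esub>" by (metis UNIV_I ext_group_simps(1))
qed (auto simp: zero_prod_def)

lemma all_bit: "(\<forall>x::bit. P x) \<longleftrightarrow> P 0 \<and> P 1"
  by (metis (full_types) bit.exhaust)

text \<open>In \<open>ext_group\<close> an element over \<open>v\<close> has square
  \<open>(0, quad v)\<close>, and elements over \<open>u\<close> and \<open>v\<close> have
  commutator \<open>(0, polar u v)\<close>. \<open>polar\<close> is the polarization of
  \<open>quad\<close>.\<close>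

definition quad :: "vec4 \<Rightarrow> vec3" where "quad v = cocycle v v"
definition polar :: "vec4 \<Rightarrow> vec4 \<Rightarrow> vec3" where "polar u v = cocycle u v + cocycle v u"

abbreviation (input) "e0 \<equiv> (1, 0, 0, 0) :: vec4"
abbreviation (input) "e1 \<equiv> (0, 1, 0, 0) :: vec4"
abbreviation (input) "e01 \<equiv> (1, 1, 0, 0) :: vec4"
abbreviation (input) "e2 \<equiv> (0, 0, 1, 0) :: vec4"
abbreviation (input) "e3 \<equiv> (0, 0, 0, 1) :: vec4"

lemma quad_eq_zero: "quad z = 0 \<Longrightarrow> z = 0"
proof -
  have "\<forall>a b c d. quad (a, b, c, d) = 0 \<longrightarrow> (a, b, c, d) = 0"
    unfolding all_bit by (simp add: quad_def zero_prod_def)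
  then show "quad z = 0 \<Longrightarrow> z = 0" by (cases z) blast
qed

lemma quad_eq_100: "quad z = (1, 0, 0) \<Longrightarrow> z \<in> {e0, e1, e01, e2}"
proof -
  have "\<forall>a b c d. quad (a, b, c, d) = (1, 0, 0) \<longrightarrow> (a, b, c, d) \<in> {e0, e1, e01, e2}"
    unfolding all_bit by (simp add: quad_def)
  then show "quad z = (1, 0, 0) \<Longrightarrow> z \<in> {e0, e1, e01, e2}" by (cases z) blast
qed

text \<open>The hypotheses say that \<open>u\<close> and \<open>v\<close> satisfy the quaternion
  relations: equal squares, equal to their commutator. Enumeration shows that the nonzero solutions
  are the pairs of distinct nonzero vectors in the plane of \<open>e0\<close> and
  \<open>e1\<close>.\<close>

lemma quaternion_pair:
  assumes "quad v = quad u" "polar u v = quad u"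
  shows "(u = 0 \<and> v = 0) \<or> (u, v) \<in> {(e0, e1), (e0, e01), (e1, e0), (e1, e01), (e01, e0), (e01, e1)}"
proof -
  obtain a b c d a' b' c' d' where uv: "v = (a, b, c, d)" "u = (a', b', c', d')" by (cases u; cases v)
  have "\<forall>a b c d a' b' c' d'. quad (a, b, c, d) = quad (a', b', c', d') \<and> polar (a', b', c', d') (a, b, c, d) = quad (a', b', c', d') \<longrightarrow>
    ((a', b', c', d') = 0 \<and> (a, b, c, d) = 0) \<or>
    ((a', b', c', d'), (a, b, c, d)) \<in> {(e0, e1), (e0, e01), (e1, e0), (e1, e01), (e01, e0), (e01, e1)}"
    unfolding all_bit by (simp add: quad_def polar_def zero_prod_def)
  from this[rule_format, OF conjI, of a b c d a' b' c' d'] show ?thesis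
    using assms unfolding uv by simp
qed

text \<open>The seven equations are relations that \<open>e0\<close>, \<open>e1\<close>,
  \<open>e2\<close>, \<open>e3\<close> satisfy, so they hold for their images under an endomorphism.
  Solving in stages keeps the enumeration small: first \<open>u\<close> and \<open>v\<close>, then
  four candidates for \<open>z\<close>, then the sixteen vectors \<open>w\<close>.\<close>

lemma rigid:
  assumes "quad v = quad u" "polar u v = quad u" "quad z = quad u" "polar u w = quad u"
    "polar z w = quad u + polar u z" "polar v z = quad u + polar u z + quad w" "polar v w = polar u z + quad w"
  shows "(u = 0 \<and> v = 0 \<and> z = 0 \<and> w = 0) \<or> (u = e0 \<and> v = e1 \<and> z = e2 \<and> w = e3)"
proof (cases "u = 0")
  case True
  then have v: "v = 0" using quaternion_pair[OF assms(1,2)] by (auto simp: zero_prod_def)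
  have "quad 0 = 0" "polar 0 x = 0" for x by (simp_all add: quad_def polar_def)
  then have "quad z = 0" "quad w = 0" using assms(3,6) True v by simp_all
  then show ?thesis using True v quad_eq_zero by blast
next
  case False
  then have uv: "(u, v) \<in> {(e0, e1), (e0, e01), (e1, e0), (e1, e01), (e01, e0), (e01, e1)}"
    using quaternion_pair[OF assms(1,2)] by blast
  then have "quad u = (1, 0, 0)" by (auto simp: quad_def)
  then have z: "z \<in> {e0, e1, e01, e2}" using assms(3) quad_eq_100 by simp
  obtain a b c d where w: "w = (a, b, c, d)" by (cases w)
  have "\<forall>a b c d. polar u (a, b, c, d) = quad u \<longrightarrow> polar z (a, b, c, d) = quad u + polar u z \<longrightarrow>
    polar v z = quad u + polar u z + quad (a, b, c, d) \<longrightarrow> polar v (a, b, c, d) = polar u z + quad (a, b, c, d) \<longrightarrow>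
    u = e0 \<and> v = e1 \<and> z = e2 \<and> (a, b, c, d) = e3"
    using uv z unfolding insert_iff empty_iff prod.inject
    by (elim disjE conjE FalseE) (simp_all add: quad_def polar_def zero_prod_def all_bit)
  then show ?thesis using assms(4-7) unfolding w by blast
qed

lemma ext_endo:
  assumes f: "f \<in> hom ext_group ext_group"
  shows "(\<forall>x. fst (f x) = 0) \<or> (\<forall>x. fst (f x) = fst x)"
proof -
  let ?m = "\<lambda>x y. x \<otimes>\<^bsub>ext_group\<^esub> y"
  have hom: "f (?m x y) = ?m (f x) (f y)" for x y
    by (rule hom_mult[OF f]) simp_all
  define g where "g x = fst (f x)" for x
  have fst_m: "fst (?m x y) = fst x + fst y" for x y by (cases x; cases y) simp
  have g: "g (?m x y) = g x + g y" for x y by (simp add: g_def hom fst_m)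
  define sq where "sq x = ?m x x" for x
  \<comment> \<open>The commutator, written with products of squares only: squares are central of
    exponent 2, so \<open>(xy)^2 x^2 y^2\<close> is \<open>[x,y]\<close>. Without inverses,
    homomorphisms pass through it directly.\<close>
  define br where "br x y = ?m (sq (?m x y)) (?m (sq x) (sq y))" for x y
  have sq: "sq x = (0, quad (fst x))" for x
    by (cases x) (simp add: sq_def quad_def)
  have br: "br x y = (0, polar (fst x) (fst y))" for x y
  proof -
    have quad_add: "quad (u + v) = (quad u + quad v) + polar u v" for u v
      by (simp add: quad_def polar_def cocycle_add algebra_simps)
    have "s + c + s = c" for s c :: vec3
    proof -
      have "s + c + s = c + (s + s)" by (simp only: ac_simps)
      then show ?thesis by simp
    qed
    then show ?thesis by (simp add: br_def sq fst_m quad_add)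
  qed
  have f_sq: "f (sq x) = sq (f x)" and f_br: "f (br x y) = br (f x) (f y)" for x y
    by (simp_all add: sq_def br_def hom)
  define E0 E1 E2 E3 :: "vec4 \<times> vec3" where E: "E0 = (e0, 0)" "E1 = (e1, 0)" "E2 = (e2, 0)" "E3 = (e3, 0)"
  have rel: "sq E1 = sq E0" "br E0 E1 = sq E0" "sq E2 = sq E0" "br E0 E3 = sq E0"
    "br E2 E3 = ?m (sq E0) (br E0 E2)" "br E1 E2 = ?m (?m (sq E0) (br E0 E2)) (sq E3)" "br E1 E3 = ?m (br E0 E2) (sq E3)"
    by (simp_all add: sq br E quad_def polar_def)
  have cases: "g E0 = 0 \<and> g E1 = 0 \<and> g E2 = 0 \<and> g E3 = 0 \<or> g E0 = e0 \<and> g E1 = e1 \<and> g E2 = e2 \<and> g E3 = e3"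
    using rel[THEN arg_cong[where f = f], unfolded hom f_sq f_br]
    by (intro rigid) (simp_all add: sq br g_def)
  have g_sq: "g (sq x) = 0" for x unfolding g_def f_sq by (simp add: sq)
  have g_br: "g (br x y) = 0" for x y unfolding g_def f_br by (simp add: br)
  \<comment> \<open>Squares and commutators of the basis elements span the second component, and
    \<open>g\<close> vanishes on both. Hence \<open>g\<close> depends on the first component only
    and is additive there.\<close>
  have g_cen: "g (0, w) = 0" for w
  proof -
    have g1: "g (0, (1, 0, 0)) = 0" using g_sq[of E0] by (simp add: sq E quad_def)
    have g2: "g (0, (0, 1, 0)) = 0" using g_br[of E0 E2] by (simp add: br E polar_def)
    have g3: "g (0, (0, 0, 1)) = 0" using g_sq[of E3] by (simp add: sq E quad_def)
    have g0: "g (0, 0) = 0" using g[of "(0, 0)" "(0, 0)"] by simp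
    have add: "g (0, w + w') = g (0, w) + g (0, w')" for w w' using g[of "(0, w)" "(0, w')"] by simp
    obtain a b c where w: "w = (a, 0, 0) + ((0, b, 0) + (0, 0, c))" by (cases w) simp
    show ?thesis unfolding w add using g1 g2 g3 g0
      by (cases a; cases b; cases c) (simp_all add: zero_prod_def)
  qed
  have g_form: "g x = (if fst (fst x) = 1 then g E0 else 0) + ((if fst (snd (fst x)) = 1 then g E1 else 0)
      + ((if fst (snd (snd (fst x))) = 1 then g E2 else 0) + (if snd (snd (snd (fst x))) = 1 then g E3 else 0)))" for x
  proof -
    have add: "g (v + v', 0) = g (v, 0) + g (v', 0)" for v v'
      using g[of "(v, 0)" "(v', 0)"] g[of "(v + v', 0)" "(0, cocycle v v')"] g_cen by simp
    obtain a b c d w where x: "x = ((a, b, c, d), w)" by (cases x) auto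
    have "g x = g ((a, b, c, d), 0)"
      using g[of "((a, b, c, d), 0)" "(0, w)"] g_cen by (simp add: x)
    also have "(a, b, c, d) = (a, 0, 0, 0) + ((0, b, 0, 0) + ((0, 0, c, 0) + (0, 0, 0, d)))" by simp
    finally show ?thesis
      unfolding add using g_cen[of 0]
      by (cases a; cases b; cases c; cases d) (simp_all add: x E zero_prod_def)
  qed
  from cases show ?thesis
  proof
    assume "g E0 = 0 \<and> g E1 = 0 \<and> g E2 = 0 \<and> g E3 = 0"
    then have "g x = 0" for x using g_form[of x] by simp
    then show ?thesis by (simp add: g_def)
  next
    assume id: "g E0 = e0 \<and> g E1 = e1 \<and> g E2 = e2 \<and> g E3 = e3"
    have "g ((a, b, c, d), w) = (a, b, c, d)" for a b c d w
      using id g_form[of "((a, b, c, d), w)"]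
      by (cases a; cases b; cases c; cases d) (simp_all add: zero_prod_def)
    then have "g x = fst x" for x by (cases x) auto
    then show ?thesis by (simp add: g_def)
  qed
qed

lemma ext_group_E:
  assumes f: "f \<in> hom ext_group ext_group"
  shows "x \<otimes>\<^bsub>ext_group\<^esub> f x = f x \<otimes>\<^bsub>ext_group\<^esub> x"
proof -
  have "fst (f x) = 0 \<or> fst (f x) = fst x" using ext_endo[OF f] by blast
  then show ?thesis
    by (cases x; cases "f x") (auto simp: add.commute)
qed

text \<open>Relabels the elements by natural numbers, since the existence claim asks for a group on
  \<open>nat\<close>. Finiteness of the carrier provides the injection \<open>h\<close>.\<close>

definition transport :: "('a \<Rightarrow> nat) \<Rightarrow> 'a monoid \<Rightarrow> nat monoid" where
  "transport h G = \<lparr>carrier = h ` carrier G,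
     monoid.mult = (\<lambda>a b. h (inv_into (carrier G) h a \<otimes>\<^bsub>G\<^esub> inv_into (carrier G) h b)), one = h \<one>\<^bsub>G\<^esub>\<rparr>"

lemma pE_group_transport:
  fixes G :: "'a monoid"
  assumes G: "group G" and inj: "inj_on h (carrier G)" and p: "Factorial_Ring.prime p"
    and E: "\<And>f x. f \<in> hom G G \<Longrightarrow> x \<in> carrier G \<Longrightarrow> x \<otimes>\<^bsub>G\<^esub> f x = f x \<otimes>\<^bsub>G\<^esub> x"
    and pow: "\<And>x. x \<in> carrier G \<Longrightarrow> x [^]\<^bsub>G\<^esub> (p ^ n) = \<one>\<^bsub>G\<^esub>"
  shows "pE_group p (transport h G)" "comm_group (transport h G) \<Longrightarrow> comm_group G"
proof -
  let ?H = "transport h G"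
  interpret G: group G by (rule G)
  have carr: "carrier ?H = h ` carrier G" by (simp add: transport_def)
  have mult: "h x \<otimes>\<^bsub>?H\<^esub> h y = h (x \<otimes>\<^bsub>G\<^esub> y)" if "x \<in> carrier G" "y \<in> carrier G" for x y
    using that inj by (simp add: transport_def inv_into_f_f)
  have one: "\<one>\<^bsub>?H\<^esub> = h \<one>\<^bsub>G\<^esub>" by (simp add: transport_def)
  have H: "group ?H"
  proof (rule groupI)
    fix a assume "a \<in> carrier ?H"
    then obtain x where x: "x \<in> carrier G" "a = h x" by (auto simp: carr)
    then have "h (inv\<^bsub>G\<^esub> x) \<otimes>\<^bsub>?H\<^esub> a = \<one>\<^bsub>?H\<^esub>" by (simp add: one mult)
    then show "\<exists>b\<in>carrier ?H. b \<otimes>\<^bsub>?H\<^esub> a = \<one>\<^bsub>?H\<^esub>"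
      using x by (intro bexI[of _ "h (inv\<^bsub>G\<^esub> x)"]) (auto simp: carr)
  qed (auto simp: carr one mult G.m_assoc)
  interpret H: group ?H by (rule H)
  have h: "h \<in> hom G ?H" by (auto simp: hom_def carr mult)
  define g where "g = inv_into (carrier G) h"
  have gh [simp]: "g (h x) = x" if "x \<in> carrier G" for x
    using that inj by (simp add: g_def)
  have g: "g \<in> hom ?H G"
  proof (rule homI)
    fix a b assume "a \<in> carrier ?H" "b \<in> carrier ?H"
    then obtain x y where "x \<in> carrier G" "a = h x" "y \<in> carrier G" "b = h y" by (auto simp: carr)
    then show "g a \<in> carrier G" "g (a \<otimes>\<^bsub>?H\<^esub> b) = g a \<otimes>\<^bsub>G\<^esub> g b" by (simp_all add: mult)
  qed
  have E_H: "E_group ?H"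
    unfolding E_group_def
  proof (intro conjI H ballI)
    fix f a assume f: "f \<in> hom ?H ?H" and "a \<in> carrier ?H"
    then obtain x where x: "x \<in> carrier G" "a = h x" by (auto simp: carr)
    have "g \<circ> (f \<circ> h) \<in> hom G G"
      by (rule hom_compose[OF hom_compose[OF h f] g])
    from E[OF this x(1)] have "x \<otimes>\<^bsub>G\<^esub> g (f a) = g (f a) \<otimes>\<^bsub>G\<^esub> x" by (simp add: x)
    moreover obtain y where y: "y \<in> carrier G" "f a = h y"
      using hom_in_carrier[OF f, of a] x by (auto simp: carr)
    ultimately have "x \<otimes>\<^bsub>G\<^esub> y = y \<otimes>\<^bsub>G\<^esub> x" by simp
    then show "a \<otimes>\<^bsub>?H\<^esub> f a = f a \<otimes>\<^bsub>?H\<^esub> a" using x y by (simp add: mult)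
  qed
  have "\<exists>k. H.ord a = p ^ k" if aH: "a \<in> carrier ?H" for a
  proof -
    obtain x where x: "x \<in> carrier G" "a = h x" using aH by (auto simp: carr)
    have "a [^]\<^bsub>?H\<^esub> (p ^ n) = \<one>\<^bsub>?H\<^esub>"
      using hom_nat_pow[OF h x(1) G H, of "p ^ n"] pow[OF x(1)] by (simp add: x(2) one)
    then have "H.ord a dvd p ^ n" using aH by (simp add: H.pow_eq_id)
    then show ?thesis using divides_primepow_nat[OF p] by blast
  qed
  then show "pE_group p ?H"
    using E_H H p by (simp add: pE_group_def p_group_def)
  assume "comm_group ?H"
  then interpret C: comm_group ?H .
  show "comm_group G"
  proof (rule G.group_comm_groupI)
    fix x y assume xy: "x \<in> carrier G" "y \<in> carrier G"
    have "h (x \<otimes>\<^bsub>G\<^esub> y) = h (y \<otimes>\<^bsub>G\<^esub> x)"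
      using C.m_comm[of "h x" "h y"] xy by (simp add: carr mult)
    then have "g (h (x \<otimes>\<^bsub>G\<^esub> y)) = g (h (y \<otimes>\<^bsub>G\<^esub> x))" by simp
    then show "x \<otimes>\<^bsub>G\<^esub> y = y \<otimes>\<^bsub>G\<^esub> x" using xy by simp
  qed
qed

lemma ex_nonabelian_2E_group: "\<exists>G :: nat monoid. pE_group 2 G \<and> order G = 2 ^ 7 \<and> \<not> comm_group G"
proof -
  have UNIV_bit: "(UNIV :: bit set) = {0, 1}" by (auto intro: bit.exhaust)
  have fin: "finite (UNIV :: bit set)" by (simp add: UNIV_bit)
  have card_bit: "card (UNIV :: bit set) = 2" by (simp add: UNIV_bit)
  have fin_ext: "finite (UNIV :: (vec4 \<times> vec3) set)" using fin by (simp add: finite_cartesian_product flip: UNIV_Times_UNIV)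
  obtain h :: "vec4 \<times> vec3 \<Rightarrow> nat" where h: "inj h"
    using finite_imp_inj_to_nat_seg[OF fin_ext] by blast
  let ?H = "transport h ext_group"
  interpret group ext_group by (rule group_ext_group)
  have pow: "x [^]\<^bsub>ext_group\<^esub> ((2::nat) ^ 2) = \<one>\<^bsub>ext_group\<^esub>" for x
  proof -
    have "x [^]\<^bsub>ext_group\<^esub> ((2::nat) ^ 2) = (x \<otimes>\<^bsub>ext_group\<^esub> x) \<otimes>\<^bsub>ext_group\<^esub> (x \<otimes>\<^bsub>ext_group\<^esub> x)"
      by (simp add: numeral_eq_Suc m_assoc del: ext_group_simps(2,3))
    also have "\<dots> = (0, 0)" by (cases x) simp
    finally show ?thesis by simp
  qed
  have "pE_group 2 ?H"
    by (rule pE_group_transport(1)[where n = 2]) (use group_ext_group h ext_group_E pow in auto)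
  moreover have "order ?H = 2 ^ 7"
  proof -
    have "card (UNIV :: (vec4 \<times> vec3) set) = 2 ^ 7"
      by (simp add: card_bit card_cartesian_product flip: UNIV_Times_UNIV)
    then show ?thesis by (simp add: order_def transport_def card_image h)
  qed
  moreover have "\<not> comm_group ?H"
  proof
    assume "comm_group ?H"
    then have "comm_group ext_group"
      by (intro pE_group_transport(2)[where n = 2 and h = h and p = 2]) (use group_ext_group h ext_group_E pow in auto)
    then interpret C: comm_group ext_group .
    show False using C.m_comm[of "(e0, 0)" "(e1, 0)"] by (simp add: zero_prod_def)
  qed
  ultimately show ?thesis by blast
qed

theorem theorem1p5:
  shows "(\<forall>(p::nat) (G :: ('a, 'b) monoid_scheme).
            Factorial_Ring.prime p \<and> odd p \<and> pE_group p G \<and> finite (carrier G) \<and> order G \<le> p ^ 7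
              \<longrightarrow> comm_group G)
       \<and> (\<exists>G :: nat monoid. pE_group 2 G \<and> order G = 2 ^ 7 \<and> \<not> comm_group G)"
proof (intro conjI allI impI)
  fix p :: nat and G :: "('a, 'b) monoid_scheme"
  assume "Factorial_Ring.prime p \<and> odd p \<and> pE_group p G \<and> finite (carrier G) \<and> order G \<le> p ^ 7"
  then have p: "Factorial_Ring.prime p" "odd p" and pE: "pE_group p G"
    and fin: "finite (carrier G)" and small: "order G \<le> p ^ 7" by auto
  interpret group G using pE by (simp add: pE_group_def p_group_def)
  interpret finite_pE_group G p
    using p(1) fin pE by unfold_locales (auto simp: pE_group_def p_group_def E_group_def)
  show "comm_group G" using p(2) small by (rule comm_group_if_small)
qed (rule ex_nonabelian_2E_group)

end
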